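(* For every $\epsilon>0$ there is a constant $c_\epsilon>0$ such that the following holds. Let $k\ge 1$ be an integer and let $G$ be a finite $S_k$-free graph without isolated vertices and with maximum degree $\Delta$. Then $\chi_{ON}(G)\le c_\epsilon\, k\,\log^{2+\epsilon}\Delta$; that is, $\chi_{ON}(G)=O(k\log^{2+\epsilon}\Delta)$.
   Context: For a graph $G$ and $v\in V(G)$, $N_G(v)=\{u\in V(G): \{u,v\}\in E(G)\}$ is the open neighborhood of $v$. A conflict-free coloring on open neighborhoods (CFON coloring) of $G$ is an assignment of colors to $V(G)$ such that for every vertex $v$, some color appears exactly once among the vertices of $N_G(v)$. The CFON chromatic number $\chi_{ON}(G)$ is the minimum number of colors in a CFON coloring of $G$. $S_k$ denotes the star $K_{1,k}$ on $k+1$ vertices; $G$ is $S_k$-free if it contains no induced subgraph isomorphic to $S_k$.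
   Formalization: The maximum degree Δ is assumed to be at least 2: for Δ = 1 the claim is false (a single edge is S_2-free and has χ_ON = 1 while log 1 = 0), and for Δ = 0, where only the empty graph remains, log Δ is undefined. *)

theory Defs
  imports Complex_Main
begin

definition simple_graph :: "'a set \<Rightarrow> 'a set set \<Rightarrow> bool" where
  "simple_graph V E \<longleftrightarrow> finite V \<and> (\<forall>e\<in>E. e \<subseteq> V \<and> card e = 2)"

definition open_nbhd :: "'a set \<Rightarrow> 'a set set \<Rightarrow> 'a \<Rightarrow> 'a set" where
  "open_nbhd V E v = {u \<in> V. {u, v} \<in> E}"

definition isolated_vertex :: "'a set \<Rightarrow> 'a set set \<Rightarrow> 'a \<Rightarrow> bool" where
  "isolated_vertex V E v \<longleftrightarrow> v \<in> V \<and> open_nbhd V E v = {}"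

text \<open>The inserted 0 only matters for the graph without vertices.\<close>

definition max_degree :: "'a set \<Rightarrow> 'a set set \<Rightarrow> nat" where
  "max_degree V E = Max (insert 0 ((\<lambda>v. card (open_nbhd V E v)) ` V))"

definition graph_isomorphic ::
  "'a set \<Rightarrow> 'a set set \<Rightarrow> 'b set \<Rightarrow> 'b set set \<Rightarrow> bool" where
  "graph_isomorphic V E V' E' \<longleftrightarrow>
     (\<exists>f. bij_betw f V V' \<and> (\<forall>u\<in>V. \<forall>v\<in>V. {u, v} \<in> E \<longleftrightarrow> {f u, f v} \<in> E'))"

definition induced_edges :: "'a set set \<Rightarrow> 'a set \<Rightarrow> 'a set set" where
  "induced_edges E W = {e \<in> E. e \<subseteq> W}"

text \<open>The star on \<open>k + 1\<close> vertices, with centre 0 and leaves \<open>1, \<dots>, k\<close>.\<close>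

definition star_verts :: "nat \<Rightarrow> nat set" where
  "star_verts k = {0..k}"

definition star_edges :: "nat \<Rightarrow> nat set set" where
  "star_edges k = {{0, i} | i. i \<in> {1..k}}"

definition star_free :: "nat \<Rightarrow> 'a set \<Rightarrow> 'a set set \<Rightarrow> bool" where
  "star_free k V E \<longleftrightarrow>
     \<not> (\<exists>W\<subseteq>V. graph_isomorphic W (induced_edges E W) (star_verts k) (star_edges k))"

definition cfon_coloring :: "'a set \<Rightarrow> 'a set set \<Rightarrow> ('a \<Rightarrow> 'c) \<Rightarrow> bool" where
  "cfon_coloring V E f \<longleftrightarrow> (\<forall>v\<in>V. \<exists>c. \<exists>!u. u \<in> open_nbhd V E v \<and> f u = c)"

text \<open>A finite graph has a CFON coloring iff it has no isolated vertex; otherwise the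
  value below is unspecified.\<close>

definition cfon_chromatic_number :: "'a set \<Rightarrow> 'a set set \<Rightarrow> nat" where
  "cfon_chromatic_number V E =
     (LEAST n. \<exists>f :: 'a \<Rightarrow> nat. f ` V \<subseteq> {..<n} \<and> cfon_coloring V E f)"

end

theory Submission
  imports Defs "HOL-Library.FuncSet"
begin

text \<open>
  Let \<open>\<Delta> \<le> 2 ^ m\<close> and call a vertex small if its degree is below \<open>s = O(m)\<close>. In an \<open>S\<^sub>k\<close>-free graph a
  vertex has at most \<open>k s\<close> small neighbours: a maximal independent set among them has fewer than
  \<open>k\<close> elements, and their degrees are below \<open>s\<close>. Hence the conflict relation ``having a common
  small neighbour'' has degree at most \<open>d = k s\<^sup>2 = O(k m\<^sup>2)\<close>, and a colouring that separates
  conflicting vertices is rainbow on the neighbourhood of every small vertex.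

  The remaining neighbourhoods are treated by two applications of the local lemma. First every
  vertex gets a random level, level \<open>i\<close> having probability \<open>2 ^ -(i + 1)\<close>, so that a vertex of degree
  about \<open>s 2 ^ i\<close> sees \<open>\<Theta>(s)\<close> vertices of level \<open>i\<close>, while each vertex has \<open>O(d / 2 ^ i + s)\<close>
  conflicts at level \<open>i\<close>. Then level \<open>i\<close> is coloured at random from its own palette of size
  \<open>O(d / 2 ^ i + s)\<close>; these sizes add up to \<open>O(k m\<^sup>2)\<close>. With high probability the neighbourhood of a
  large vertex contains, at the relevant level, a vertex whose colour differs from those of its
  conflicts and of the rest of the neighbourhood. Finally all vertices whose colour clashes
  with a conflict at their level are recoloured from a separate palette of \<open>d + 1\<close> colours, properly
  with respect to the conflict relation. This gives the bound \<open>O(k log\<^sup>2 \<Delta>)\<close>.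
\<close>

section \<open>Counting in finite product spaces\<close>

text \<open>The map \<open>?h\<close>, exchanging \<open>c\<close> with the value at
  \<open>u\<close>, is an involution on \<open>PiE V B \<times> B u\<close>: redrawing one
  coordinate preserves the uniform distribution.\<close>

lemma sum_PiE_resample:
  fixes \<Phi> :: "('v \<Rightarrow> 'b) \<Rightarrow> real"
  assumes "u \<in> V"
  shows "(\<Sum>r\<in>PiE V B. \<Sum>c\<in>B u. \<Phi> (r(u := c))) = real (card (B u)) * (\<Sum>r\<in>PiE V B. \<Phi> r)"
proof -
  let ?h = "\<lambda>(r, c). (r(u := c), r u)"
  have "(\<Sum>r\<in>PiE V B. \<Sum>c\<in>B u. \<Phi> (r(u := c)))
      = (\<Sum>(r, c)\<in>PiE V B \<times> B u. \<Phi> (r(u := c)))"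
    by (simp add: sum.cartesian_product)
  also have "\<dots> = (\<Sum>(r, c)\<in>PiE V B \<times> B u. \<Phi> r)"
    using assms by (intro sum.reindex_bij_witness[of _ ?h ?h])
      (auto simp: PiE_iff extensional_def)
  also have "\<dots> = (\<Sum>r\<in>PiE V B. \<Sum>c\<in>B u. \<Phi> r)"
    by (simp only: sum.cartesian_product)
  finally show ?thesis by (simp add: sum_distrib_left)
qed

text \<open>
  Exponential moments for adaptive events: the target set of a coordinate may depend on the
  coordinates preceding it in the list and on those outside the list.
\<close>

lemma sum_power_hits_le:
  fixes q z :: real
  assumes fin: "\<And>u. u \<in> V \<Longrightarrow> finite (B u)"
    and ne: "\<And>u. u \<in> V \<Longrightarrow> B u \<noteq> {}"
    and z: "z \<ge> 1" and q: "q \<ge> 0"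
    and us: "distinct us" "set us \<subseteq> V"
    and self: "\<And>u r c. u \<in> set us \<Longrightarrow> F u (r(u := c)) = F u r"
    and later: "sorted_wrt (\<lambda>w u. \<forall>r c. F w (r(u := c)) = F w r) us"
    and bound: "\<And>u r. u \<in> set us \<Longrightarrow> r \<in> PiE V B \<Longrightarrow> 
        real (card (B u \<inter> F u r)) \<le> q * real (card (B u))"
  shows "(\<Sum>r\<in>PiE V B. z ^ length (filter (\<lambda>u. r u \<in> F u r) us))
    \<le> (1 + (z - 1) * q) ^ length us * real (card (PiE V B))"
  using us self later bound
proof (induction us rule: rev_induct)
  case Nil
  then show ?case by simp
next
  case (snoc u us)
  define hits where "hits r = length (filter (\<lambda>u. r u \<in> F u r) us)" for r
  have u: "u \<in> V" "u \<notin> set us" using snoc.prems by auto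
  have cpos: "real (card (B u)) > 0"
    using fin[OF u(1)] ne[OF u(1)] by (simp add: card_gt_0_iff)
  have IH: "(\<Sum>r\<in>PiE V B. z ^ hits r) \<le> (1 + (z - 1) * q) ^ length us * real (card (PiE V B))"
    unfolding hits_def by (rule snoc.IH) (use snoc.prems in \<open>auto simp: sorted_wrt_append\<close>)
  have upd: "hits (r(u := c)) = hits r" for r c
  proof -
    have "F w (r(u := c)) = F w r" if "w \<in> set us" for w
      using snoc.prems(4) that unfolding sorted_wrt_append by simp
    then have "filter (\<lambda>w. (r(u := c)) w \<in> F w (r(u := c))) us = filter (\<lambda>w. r w \<in> F w r) us"
      using u by (intro filter_cong refl) auto
    then show ?thesis by (simp add: hits_def)
  qed
  have inner: "(\<Sum>c\<in>B u. z ^ (if c \<in> F u r then 1 else 0))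
      \<le> real (card (B u)) * (1 + (z - 1) * q)" if "r \<in> PiE V B" for r
  proof -
    have "(\<Sum>c\<in>B u. z ^ (if c \<in> F u r then 1 else 0))
        = (\<Sum>c\<in>B u. 1 + (if c \<in> F u r then z - 1 else 0))"
      by (intro sum.cong) auto
    also have "\<dots> = real (card (B u)) + (z - 1) * real (card (B u \<inter> F u r))"
      using fin[OF u(1)] by (simp add: sum.distrib sum.If_cases Int_def)
    also have "\<dots> \<le> real (card (B u)) + (z - 1) * (q * real (card (B u)))"
      using snoc.prems(5)[OF _ that, of u] z by (intro add_left_mono mult_left_mono) auto
    finally show ?thesis by (simp add: algebra_simps)
  qed
  \<comment> \<open>The factor \<open>card (B u)\<close> allows coordinate \<open>u\<close> to be
    redrawn inside the sum, in place of conditioning on the others. By \<open>upd\<close> the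
    earlier hits ignore the new value, so it enters the last factor only, which \<open>inner\<close>
    averages.\<close>
  have "real (card (B u)) * (\<Sum>r\<in>PiE V B. z ^ length (filter (\<lambda>u. r u \<in> F u r) (us @ [u])))
     = (\<Sum>r\<in>PiE V B. \<Sum>c\<in>B u.
          z ^ length (filter (\<lambda>w. (r(u := c)) w \<in> F w (r(u := c))) (us @ [u])))"
    by (rule sum_PiE_resample[OF u(1), symmetric])
  also have "\<dots> = (\<Sum>r\<in>PiE V B. \<Sum>c\<in>B u. z ^ hits (r(u := c)) * z ^ (if c \<in> F u r then 1 else 0))"
  proof (intro sum.cong refl)
    fix r c
    have "F u (r(u := c)) = F u r" by (rule snoc.prems(3)) simp
    then have "length (filter (\<lambda>w. (r(u := c)) w \<in> F w (r(u := c))) (us @ [u]))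
        = hits (r(u := c)) + (if c \<in> F u r then 1 else 0)"
      by (simp add: hits_def del: fun_upd_apply add: fun_upd_same)
    then show "z ^ length (filter (\<lambda>w. (r(u := c)) w \<in> F w (r(u := c))) (us @ [u]))
        = z ^ hits (r(u := c)) * z ^ (if c \<in> F u r then 1 else 0)"
      by (simp only: power_add)
  qed
  also have "\<dots> = (\<Sum>r\<in>PiE V B. z ^ hits r * (\<Sum>c\<in>B u. z ^ (if c \<in> F u r then 1 else 0)))"
    by (simp only: upd sum_distrib_left)
  also have "\<dots> \<le> (\<Sum>r\<in>PiE V B. z ^ hits r * (real (card (B u)) * (1 + (z - 1) * q)))"
    using inner z by (intro sum_mono mult_left_mono) auto
  also have "\<dots> = real (card (B u)) * ((1 + (z - 1) * q) * (\<Sum>r\<in>PiE V B. z ^ hits r))"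
    by (simp add: sum_distrib_left sum_distrib_right mult_ac)
  finally have "(\<Sum>r\<in>PiE V B. z ^ length (filter (\<lambda>u. r u \<in> F u r) (us @ [u])))
      \<le> (1 + (z - 1) * q) * (\<Sum>r\<in>PiE V B. z ^ hits r)"
    using cpos by simp
  also have "\<dots> \<le> (1 + (z - 1) * q) * ((1 + (z - 1) * q) ^ length us * real (card (PiE V B)))"
    using IH z q by (intro mult_left_mono) auto
  finally show ?case by (simp add: mult_ac)
qed

text \<open>Markov's inequality for \<open>z\<close> to the number of hits, multiplied out so that
  no division occurs.\<close>

lemma hits_tail:
  fixes q z :: real
  assumes V: "finite V" and fin: "\<And>u. u \<in> V \<Longrightarrow> finite (B u)"
    and ne: "\<And>u. u \<in> V \<Longrightarrow> B u \<noteq> {}"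
    and z: "z \<ge> 1" and q: "q \<ge> 0"
    and us: "distinct us" "set us \<subseteq> V"
    and self: "\<And>u r c. u \<in> set us \<Longrightarrow> F u (r(u := c)) = F u r"
    and later: "sorted_wrt (\<lambda>w u. \<forall>r c. F w (r(u := c)) = F w r) us"
    and bound: "\<And>u r. u \<in> set us \<Longrightarrow> r \<in> PiE V B \<Longrightarrow> 
        real (card (B u \<inter> F u r)) \<le> q * real (card (B u))"
  shows "z ^ n * real (card {r \<in> PiE V B. n \<le> card {u \<in> set us. r u \<in> F u r}})
    \<le> (1 + (z - 1) * q) ^ length us * real (card (PiE V B))"
proof -
  have finP: "finite (PiE V B)" using V fin by (intro finite_PiE) auto
  have len: "length (filter (\<lambda>u. r u \<in> F u r) us) = card {u \<in> set us. r u \<in> F u r}" for r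
    using distinct_card[OF distinct_filter[OF us(1)], of "\<lambda>u. r u \<in> F u r"] by simp
  let ?S = "{r \<in> PiE V B. n \<le> card {u \<in> set us. r u \<in> F u r}}"
  have "z ^ n * real (card ?S) = (\<Sum>r\<in>?S. z ^ n)" by simp
  also have "\<dots> \<le> (\<Sum>r\<in>?S. z ^ length (filter (\<lambda>u. r u \<in> F u r) us))"
    using z by (intro sum_mono power_increasing) (auto simp: len)
  also have "\<dots> \<le> (\<Sum>r\<in>PiE V B. z ^ length (filter (\<lambda>u. r u \<in> F u r) us))"
    using z finP by (intro sum_mono2) auto
  also have "\<dots> \<le> (1 + (z - 1) * q) ^ length us * real (card (PiE V B))"
    by (rule sum_power_hits_le[OF fin ne z q us self later bound])
  finally show ?thesis .
qed

text \<open>The non-adaptive case: the target \<open>Y\<close> is constant, so every enumeration of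
  \<open>T\<close> meets the dependence conditions.\<close>

lemma count_tail:
  fixes q z :: real
  assumes V: "finite V" and fin: "\<And>u. u \<in> V \<Longrightarrow> finite (B u)"
    and ne: "\<And>u. u \<in> V \<Longrightarrow> B u \<noteq> {}"
    and z: "z \<ge> 1" and q: "q \<ge> 0" and T: "T \<subseteq> V"
    and bound: "\<And>u. u \<in> T \<Longrightarrow> real (card (B u \<inter> Y)) \<le> q * real (card (B u))"
  shows "z ^ n * real (card {r \<in> PiE V B. n \<le> card {u \<in> T. r u \<in> Y}})
    \<le> (1 + (z - 1) * q) ^ card T * real (card (PiE V B))"
proof -
  obtain us where us: "set us = T" "distinct us"
    using finite_distinct_list finite_subset[OF T V] by blast
  have "sorted_wrt (\<lambda>w u. True) us" by (induction us) auto
  then show ?thesis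
    using hits_tail[OF V fin ne z q us(2), where F = "\<lambda>_ _. Y" and n = n] us T bound
    by (auto simp: distinct_card[symmetric])
qed

text \<open>Independence in multiplied form. Exchanging the coordinates outside \<open>S\<close>
  between two samples turns a sample with both properties and an arbitrary one into a sample with
  \<open>P\<close> and one with \<open>Q\<close>, bijectively.\<close>

lemma card_PiE_independent:
  assumes P: "\<And>r r'. r \<in> PiE V B \<Longrightarrow> r' \<in> PiE V B \<Longrightarrow> (\<forall>u\<in>S. r u = r' u) \<Longrightarrow> P r \<longleftrightarrow> P r'"
    and Q: "\<And>r r'. r \<in> PiE V B \<Longrightarrow> r' \<in> PiE V B \<Longrightarrow> (\<forall>u\<in>V - S. r u = r' u) \<Longrightarrow> Q r \<longleftrightarrow> Q r'"
  shows "card {r \<in> PiE V B. P r \<and> Q r} * card (PiE V B)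
    = card {r \<in> PiE V B. P r} * card {r \<in> PiE V B. Q r}"
proof -
  define mix where "mix x y = (\<lambda>u. if u \<in> S then x u else y u)" for x y :: "'a \<Rightarrow> 'b"
  let ?\<Omega> = "PiE V B" and ?h = "\<lambda>(x, y). (mix x y, mix y x)"
  have mix: "mix x y \<in> ?\<Omega>" if "x \<in> ?\<Omega>" "y \<in> ?\<Omega>" for x y
    using that by (auto simp: mix_def PiE_iff extensional_def)
  have inv: "mix (mix x y) (mix y x) = x" for x y by (auto simp: mix_def)
  have Pm: "P (mix x y) \<longleftrightarrow> P x" if "x \<in> ?\<Omega>" "y \<in> ?\<Omega>" for x y
    by (rule P) (use that mix in \<open>auto simp: mix_def\<close>)
  have Qm: "Q (mix y x) \<longleftrightarrow> Q x" if "x \<in> ?\<Omega>" "y \<in> ?\<Omega>" for x y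
    by (rule Q) (use that mix in \<open>auto simp: mix_def\<close>)
  have "bij_betw ?h ({r \<in> ?\<Omega>. P r \<and> Q r} \<times> ?\<Omega>) ({r \<in> ?\<Omega>. P r} \<times> {r \<in> ?\<Omega>. Q r})"
    by (rule bij_betw_byWitness[where f' = ?h])
       (use mix inv Pm Qm in \<open>auto\<close>)
  from bij_betw_same_card[OF this] show ?thesis by (simp add: card_cartesian_product)
qed

section \<open>The symmetric local lemma\<close>

text \<open>The usual induction: among the outcomes \<open>G J\<close> avoiding all events of
  \<open>J\<close>, each \<open>A i\<close> has proportion at most \<open>2 * q\<close>
  (\<open>key\<close>). Events are then avoided one after the other.\<close>

lemma lovasz_local_counting:
  fixes A :: "'i \<Rightarrow> 'r set" and q :: real
  assumes \<Omega>: "finite \<Omega>" "\<Omega> \<noteq> {}" and I: "finite I"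
    and A: "\<And>i. i \<in> I \<Longrightarrow> A i \<subseteq> \<Omega>"
    and q: "q \<ge> 0" "4 * q * real D \<le> 1" "D \<ge> 1"
    and prob: "\<And>i. i \<in> I \<Longrightarrow> real (card (A i)) \<le> q * real (card \<Omega>)"
    and nbr: "\<And>i. i \<in> I \<Longrightarrow> card (\<Gamma> i) \<le> D" "\<And>i. i \<in> I \<Longrightarrow> finite (\<Gamma> i)"
    and indep: "\<And>i J. i \<in> I \<Longrightarrow> J \<subseteq> I \<Longrightarrow> J \<inter> \<Gamma> i = {} \<Longrightarrow>
        card (A i \<inter> (\<Omega> - \<Union>(A ` J))) * card \<Omega> = card (A i) * card (\<Omega> - \<Union>(A ` J))"
  shows "\<Omega> - \<Union>(A ` I) \<noteq> {}"
proof -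
  define G where "G J = \<Omega> - \<Union>(A ` J)" for J
  have finG: "finite (G J)" for J unfolding G_def using \<Omega> by auto
  have \<Omega>pos: "real (card \<Omega>) > 0" using \<Omega> by (simp add: card_gt_0_iff)
  have key: "real (card (A i \<inter> G J)) \<le> 2 * q * real (card (G J))"
    if "i \<in> I" "J \<subseteq> I" for i J
    using finite_subset[OF that(2) I] that
  proof (induction J arbitrary: i rule: finite_psubset_induct)
    case (psubset J)
    define J1 where "J1 = J \<inter> \<Gamma> i"
    define J2 where "J2 = J - \<Gamma> i"
    have "real (card (A i \<inter> G J2)) * real (card \<Omega>) = real (card (A i)) * real (card (G J2))"
      unfolding of_nat_mult[symmetric] G_def using indep[of i J2] psubset.prems
      by (intro arg_cong[where f = real]) (auto simp: J2_def)
    also have "\<dots> \<le> q * real (card \<Omega>) * real (card (G J2))"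
      using prob[OF psubset.prems(1)] by (intro mult_right_mono) auto
    finally have "real (card \<Omega>) * real (card (A i \<inter> G J2)) \<le> real (card \<Omega>) * (q * real (card (G J2)))"
      by (simp add: mult_ac)
    then have 2: "real (card (A i \<inter> G J2)) \<le> q * real (card (G J2))" using \<Omega>pos by simp
    \<comment> \<open>The at most \<open>D\<close> events of \<open>J1\<close> cover at most
      \<open>2 * q * D \<le> 1 / 2\<close> of \<open>G J2\<close>. The case of empty
      \<open>J1\<close> is separate because the induction hypothesis reaches proper subsets of
      \<open>J\<close> only.\<close>
    have half: "real (card (G J2)) \<le> 2 * real (card (G J))"
    proof (cases "J1 = {}")
      case True
      then have "J2 = J" by (auto simp: J1_def J2_def)
      then show ?thesis by simp
    next
      case False
      then have J2: "J2 \<subset> J" by (auto simp: J1_def J2_def)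
      have "G J2 \<subseteq> G J \<union> (\<Union>j\<in>J1. A j \<inter> G J2)"
        by (auto simp: G_def J1_def J2_def)
      moreover have finJ1: "finite J1" using nbr(2)[OF psubset.prems(1)] by (simp add: J1_def)
      ultimately have "card (G J2) \<le> card (G J) + card (\<Union>j\<in>J1. A j \<inter> G J2)"
        using finG by (meson card_Un_le card_mono finite_Int finite_UN finite_UnI order_trans)
      also have "card (\<Union>j\<in>J1. A j \<inter> G J2) \<le> (\<Sum>j\<in>J1. card (A j \<inter> G J2))"
        by (rule card_UN_le[OF finJ1])
      finally have "real (card (G J2)) \<le> real (card (G J)) + (\<Sum>j\<in>J1. real (card (A j \<inter> G J2)))"
        unfolding of_nat_sum[symmetric] of_nat_add[symmetric] of_nat_le_iff by simp
      also have "(\<Sum>j\<in>J1. real (card (A j \<inter> G J2))) \<le> (\<Sum>j\<in>J1. 2 * q * real (card (G J2)))"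
        using psubset.prems by (intro sum_mono psubset.IH[OF J2]) (auto simp: J1_def J2_def)
      also have "\<dots> = real (card J1) * (2 * q * real (card (G J2)))" by simp
      also have "\<dots> \<le> real D * (2 * q * real (card (G J2)))"
        using nbr[OF psubset.prems(1)] q card_mono[of "\<Gamma> i" J1]
        by (intro mult_right_mono) (auto simp: J1_def)
      also have "\<dots> = (4 * q * real D) * (real (card (G J2)) / 2)" by simp
      also have "\<dots> \<le> 1 * (real (card (G J2)) / 2)"
        using q by (intro mult_right_mono) auto
      finally show ?thesis by simp
    qed
    have "real (card (A i \<inter> G J)) \<le> real (card (A i \<inter> G J2))"
      using finG by (intro of_nat_mono card_mono) (auto simp: G_def J2_def)
    also have "\<dots> \<le> q * (2 * real (card (G J)))"
      using 2 half q(1) by (meson mult_left_mono order_trans)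
    finally show ?case by simp
  qed
  \<comment> \<open>Adding one event to \<open>J\<close> keeps at least the fraction
    \<open>1 - 2 * q\<close> of \<open>G J\<close>, which must therefore be positive.\<close>
  have "q < 1 / 2"
  proof -
    have "4 * q * 1 \<le> 4 * q * real D" using q by (intro mult_left_mono) auto
    then show ?thesis using q by linarith
  qed
  have "real (card (G J)) > 0" if "J \<subseteq> I" for J
    using finite_subset[OF that I] that
  proof (induction J rule: finite_induct)
    case empty
    then show ?case using \<Omega>pos by (simp add: G_def)
  next
    case (insert i J)
    have "G J = G (insert i J) \<union> (A i \<inter> G J)" by (auto simp: G_def)
    then have "real (card (G J)) \<le> real (card (G (insert i J))) + real (card (A i \<inter> G J))"
      by (metis card_Un_le of_nat_add of_nat_mono)
    also have "\<dots> \<le> real (card (G (insert i J))) + 2 * q * real (card (G J))"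
      using key[of i J] insert by auto
    finally have "(1 - 2 * q) * real (card (G J)) \<le> real (card (G (insert i J)))"
      by (simp add: algebra_simps)
    moreover have "(1 - 2 * q) * real (card (G J)) > 0"
      using insert \<open>q < 1 / 2\<close> by (intro mult_pos_pos) auto
    ultimately show ?case by linarith
  qed
  from this[OF subset_refl] have "G I \<noteq> {}" by auto
  then show ?thesis unfolding G_def .
qed

text \<open>\<open>D\<close> bounds both the coordinates read by an event and the events reading a
  coordinate. Hence at most \<open>D\<^sup>2\<close> events share a coordinate with a given one,
  which explains the factor \<open>4 * D\<^sup>2\<close>.\<close>

lemma lovasz_local_product:
  fixes A :: "'i \<Rightarrow> ('v \<Rightarrow> 'b) \<Rightarrow> bool"
  assumes V: "finite V" and B: "\<And>u. u \<in> V \<Longrightarrow> finite (B u)" "\<And>u. u \<in> V \<Longrightarrow> B u \<noteq> {}"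
    and I: "finite I"
    and S: "\<And>i. i \<in> I \<Longrightarrow> S i \<subseteq> V"
    and dep: "\<And>i r r'. i \<in> I \<Longrightarrow> (\<forall>u\<in>S i. r u = r' u) \<Longrightarrow> A i r \<longleftrightarrow> A i r'"
    and D: "D \<ge> 1" "\<And>i. i \<in> I \<Longrightarrow> card (S i) \<le> D"
      "\<And>u. u \<in> V \<Longrightarrow> card {i \<in> I. u \<in> S i} \<le> D"
    and prob: "\<And>i. i \<in> I \<Longrightarrow> 4 * D\<^sup>2 * card {r \<in> PiE V B. A i r} \<le> card (PiE V B)"
  shows "\<exists>r\<in>PiE V B. \<forall>i\<in>I. \<not> A i r"
proof -
  let ?\<Omega> = "PiE V B"
  define E where "E i = {r \<in> ?\<Omega>. A i r}" for i
  define \<Gamma> where "\<Gamma> i = {j \<in> I. S j \<inter> S i \<noteq> {}}" for i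
  have "?\<Omega> - \<Union>(E ` I) \<noteq> {}"
  proof (rule lovasz_local_counting[where q = "1 / (4 * real (D\<^sup>2))" and D = "D\<^sup>2" and \<Gamma> = \<Gamma>])
    show "finite ?\<Omega>" using V B by (intro finite_PiE) auto
    show "?\<Omega> \<noteq> {}" using B by (simp add: PiE_eq_empty_iff)
    show "real (card (E i)) \<le> 1 / (4 * real (D\<^sup>2)) * real (card ?\<Omega>)" if "i \<in> I" for i
    proof -
      have "real (4 * D\<^sup>2 * card (E i)) \<le> real (card ?\<Omega>)"
        using prob[OF that] unfolding E_def of_nat_le_iff .
      then show ?thesis using D(1) by (simp add: field_simps)
    qed
    show "card (\<Gamma> i) \<le> D\<^sup>2" if "i \<in> I" for i
    proof -
      have finS: "finite (S i)" using S[OF that] V finite_subset by blast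
      have "\<Gamma> i = (\<Union>u\<in>S i. {j \<in> I. u \<in> S j})" by (auto simp: \<Gamma>_def)
      then have "card (\<Gamma> i) \<le> (\<Sum>u\<in>S i. card {j \<in> I. u \<in> S j})"
        using card_UN_le[OF finS] by metis
      also have "\<dots> \<le> of_nat (card (S i)) * D"
        using D(3) S[OF that] by (intro sum_bounded_above) auto
      also have "\<dots> \<le> D * D" using D(2)[OF that] by simp
      finally show ?thesis by (simp add: power2_eq_square)
    qed
    show "card (E i \<inter> (?\<Omega> - \<Union>(E ` J))) * card ?\<Omega> = card (E i) * card (?\<Omega> - \<Union>(E ` J))"
      if "i \<in> I" "J \<subseteq> I" "J \<inter> \<Gamma> i = {}" for i J
    proof -
      have eq: "E i \<inter> (?\<Omega> - \<Union>(E ` J)) = {r \<in> ?\<Omega>. A i r \<and> (\<forall>j\<in>J. \<not> A j r)}"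
        "?\<Omega> - \<Union>(E ` J) = {r \<in> ?\<Omega>. \<forall>j\<in>J. \<not> A j r}" "E i = {r \<in> ?\<Omega>. A i r}"
        by (auto simp: E_def)
      have "card {r \<in> ?\<Omega>. A i r \<and> (\<forall>j\<in>J. \<not> A j r)} * card ?\<Omega>
          = card {r \<in> ?\<Omega>. A i r} * card {r \<in> ?\<Omega>. \<forall>j\<in>J. \<not> A j r}"
      proof (rule card_PiE_independent[where S = "S i"])
        fix r r' :: "'v \<Rightarrow> 'b" assume agree: "\<forall>u\<in>V - S i. r u = r' u"
        have "A j r \<longleftrightarrow> A j r'" if "j \<in> J" for j
        proof (rule dep)
          show "j \<in> I" using that \<open>J \<subseteq> I\<close> by auto
          then show "\<forall>u\<in>S j. r u = r' u"
            using agree S[of j] that \<open>J \<inter> \<Gamma> i = {}\<close> by (fastforce simp: \<Gamma>_def)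
        qed
        then show "(\<forall>j\<in>J. \<not> A j r) \<longleftrightarrow> (\<forall>j\<in>J. \<not> A j r')" by auto
      qed (use dep that in auto)
      then show ?thesis by (subst eq(1), subst eq(2), subst eq(3))
    qed
  qed (use D I in \<open>auto simp: E_def \<Gamma>_def\<close>)
  then show ?thesis by (auto simp: E_def)
qed

section \<open>Tail bound for repeated colours\<close>

text \<open>In use, \<open>X\<close> is the part of a neighbourhood at one level and
  \<open>C u\<close> holds the conflicts of \<open>u\<close> there. At least half of
  \<open>X\<close> must be hits, each of conditional probability at most 1/16. With
  \<open>z = 16\<close> the tail gains \<open>16 ^ n \<ge> 4 ^ card X\<close> against a moment of at
  most \<open>(31 / 16) ^ card X \<le> 2 ^ card X\<close>.\<close>

lemma monochromatic_tail:
  assumes V: "finite V" and B: "\<And>u. u \<in> V \<Longrightarrow> finite (B u)" "\<And>u. u \<in> V \<Longrightarrow> B u \<noteq> {}"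
    and X: "X \<subseteq> V" and C: "\<And>u. u \<in> X \<Longrightarrow> finite (C u)"
      "\<And>u. u \<in> X \<Longrightarrow> 16 * card (C u \<union> X) \<le> card (B u)"
  shows "2 ^ card X * card {r \<in> PiE V B. \<forall>u\<in>X. \<exists>w\<in>C u \<union> X - {u}. r w = r u} \<le> card (PiE V B)"
proof -
  have finX: "finite X" using X V finite_subset by blast
  obtain us where us: "set us = X" "distinct us" using finite_distinct_list[OF finX] by blast
  \<comment> \<open>Reveal \<open>X\<close> in the order of \<open>us\<close>, after the rest. A non-hit differs from all of \<open>C u - X\<close> and from
    its predecessors, so it can only be repeated by a later hit: at least half of \<open>X\<close> are hits.\<close>
  define before where "before u = set (takeWhile (\<lambda>w. w \<noteq> u) us)" for u
  define F where "F u r = r ` ((C u - X) \<union> before u)" for u and r :: "'a \<Rightarrow> 'b"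
  have before_nth: "before (us ! j) = set (take j us)" if "j < length us" for j
    unfolding before_def using us(2) that
    by (subst takeWhile_eq_take_P_nth[where n = j]) (auto simp: nth_eq_iff_index_eq)
  have before_iff: "us ! i \<in> before (us ! j) \<longleftrightarrow> i < j" if "i < length us" "j < length us" for i j
    unfolding before_nth[OF that(2)] using us(2) that
    by (auto simp: in_set_conv_nth nth_eq_iff_index_eq)
  have before_sub: "before u \<subseteq> X - {u}" for u
    unfolding before_def using us(1) by (auto dest: set_takeWhileD)
  have before_total: "u \<in> before w \<or> w \<in> before u" if "u \<in> X" "w \<in> X" "u \<noteq> w" for u w
    using that us(1) by (metis before_iff in_set_conv_nth linorder_neqE_nat)
  define n where "n = (card X + 1) div 2"
  \<comment> \<open>Removing \<open>X\<close> from \<open>C u\<close> in \<open>F\<close> matters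
    here: a conflict inside \<open>X\<close> may come later in \<open>us\<close>, and
    \<open>F u\<close> must not read it. Earlier ones return through
    \<open>before u\<close>.\<close>
  have indep: "F u (r(w := c)) = F u r" if "w \<in> X" "w \<notin> before u" for u w r c
    using that by (auto simp: F_def)
  have many_hits: "n \<le> card {u \<in> X. r u \<in> F u r}"
    if bad: "\<forall>u\<in>X. \<exists>w\<in>C u \<union> X - {u}. r w = r u" for r
  proof -
    let ?hit = "{u \<in> X. r u \<in> F u r}" and ?free = "{u \<in> X. r u \<notin> F u r}"
    have "inj_on r ?free"
    proof (rule inj_onI)
      fix u w assume *: "u \<in> ?free" "w \<in> ?free" "r u = r w"
      show "u = w"
      proof (rule ccontr)
        assume "u \<noteq> w"
        then consider "u \<in> before w" | "w \<in> before u" using before_total * by blast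
        then show False
        proof cases
          case 1
          then have "r u \<in> F w r" unfolding F_def by (intro imageI) auto
          then show False using * by simp
        next
          case 2
          then have "r w \<in> F u r" unfolding F_def by (intro imageI) auto
          then show False using * by simp
        qed
      qed
    qed
    then have "card ?free = card (r ` ?free)" by (simp add: card_image)
    also have "r ` ?free \<subseteq> r ` ?hit"
    proof (rule image_subsetI)
      fix u assume u: "u \<in> ?free"
      obtain w where w: "w \<in> C u \<union> X - {u}" "r w = r u" using bad u by blast
      have "r w \<notin> F u r" using u w(2) by simp
      then have "w \<notin> (C u - X) \<union> before u" unfolding F_def by (meson imageI)
      then have "w \<in> X" "u \<in> before w" using before_total[of u w] u w(1) by auto
      then have "r u \<in> F w r" unfolding F_def by (intro imageI) auto
      then have "r w \<in> F w r" using w(2) by simp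
      then show "r u \<in> r ` ?hit" using \<open>w \<in> X\<close> w(2) by (metis (mono_tags, lifting) image_eqI mem_Collect_eq)
    qed
    then have "card (r ` ?free) \<le> card (r ` ?hit)" using finX by (intro card_mono) auto
    also have "\<dots> \<le> card ?hit" using finX by (intro card_image_le) auto
    finally have "card ?free \<le> card ?hit" .
    moreover have "card X = card ?hit + card ?free"
      using finX by (subst card_Un_disjoint[symmetric]) (auto intro: arg_cong[where f = card])
    ultimately show ?thesis unfolding n_def by linarith
  qed
  let ?\<Omega> = "PiE V B"
  have fin\<Omega>: "finite ?\<Omega>" using V B by (intro finite_PiE) auto
  have bnd: "real (card (B u \<inter> F u r)) \<le> 1 / 16 * real (card (B u))" if "u \<in> set us" for u r
  proof -
    have u: "u \<in> X" using that us by simp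
    have "card (B u \<inter> F u r) \<le> card (F u r)"
      using C(1)[OF u] finX before_sub finite_subset by (intro card_mono) (auto simp: F_def before_def)
    also have "\<dots> \<le> card ((C u - X) \<union> before u)"
      unfolding F_def using C(1)[OF u] by (intro card_image_le) (auto simp: before_def)
    also have "\<dots> \<le> card (C u \<union> X)"
      using C(1)[OF u] finX before_sub[of u] by (intro card_mono) auto
    finally have "16 * card (B u \<inter> F u r) \<le> card (B u)" using C(2)[OF u] by linarith
    then show ?thesis by linarith
  qed
  have "16 ^ n * real (card {r \<in> ?\<Omega>. n \<le> card {u \<in> set us. r u \<in> F u r}})
      \<le> (1 + (16 - 1) * (1 / 16)) ^ length us * real (card ?\<Omega>)"
  proof (rule hits_tail[OF V B _ _ us(2)])
    show "sorted_wrt (\<lambda>w u. \<forall>r c. F w (r(u := c)) = F w r) us"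
      unfolding sorted_wrt_iff_nth_less
    proof (intro allI impI)
      fix i j r c assume "i < j" "j < length us"
      then show "F (us ! i) (r(us ! j := c)) = F (us ! i) r"
        using us(1) by (intro indep) (auto simp: before_iff)
    qed
    show "F u (r(u := c)) = F u r" if "u \<in> set us" for u r c
      using that us(1) before_sub[of u] by (intro indep) auto
  qed (use us X bnd in auto)
  also have "\<dots> \<le> 2 ^ card X * real (card ?\<Omega>)"
    using distinct_card[OF us(2)] us(1) by (intro mult_right_mono power_mono) (auto intro: power_mono)
  finally have 1: "16 ^ n * real (card {r \<in> ?\<Omega>. n \<le> card {u \<in> X. r u \<in> F u r}})
      \<le> 2 ^ card X * real (card ?\<Omega>)" using us by simp
  let ?bad = "{r \<in> ?\<Omega>. \<forall>u\<in>X. \<exists>w\<in>C u \<union> X - {u}. r w = r u}"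
  have "card ?bad \<le> card {r \<in> ?\<Omega>. n \<le> card {u \<in> X. r u \<in> F u r}}"
    using fin\<Omega> many_hits by (intro card_mono) auto
  then have "16 ^ n * real (card ?bad) \<le> 16 ^ n * real (card {r \<in> ?\<Omega>. n \<le> card {u \<in> X. r u \<in> F u r}})"
    by simp
  also note 1
  finally have 2: "16 ^ n * real (card ?bad) \<le> 2 ^ card X * real (card ?\<Omega>)" .
  have "(2::real) ^ card X * 2 ^ card X = 4 ^ card X" by (simp add: power_mult_distrib[symmetric])
  also have "\<dots> \<le> 4 ^ (2 * n)" by (intro power_increasing) (auto simp: n_def)
  also have "\<dots> = 16 ^ n" by (simp add: power_mult)
  finally have "2 ^ card X * 2 ^ card X * real (card ?bad) \<le> 16 ^ n * real (card ?bad)"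
    by (intro mult_right_mono) auto
  from order_trans[OF this 2]
  have "2 ^ card X * (2 ^ card X * real (card ?bad)) \<le> 2 ^ card X * real (card ?\<Omega>)"
    unfolding mult.assoc .
  then have "2 ^ card X * real (card ?bad) \<le> real (card ?\<Omega>)"
    by (rule mult_left_le_imp_le) simp
  then have "real (2 ^ card X * card ?bad) \<le> real (card ?\<Omega>)" by simp
  then show ?thesis unfolding of_nat_le_iff .
qed

section \<open>Elementary estimates for levels and palettes\<close>

lemma one_minus_inverse_power_le:
  assumes "K \<ge> (1::nat)"
  shows "(1 - 1 / real K) ^ K \<le> 1 / 2"
proof -
  have "(1 - 1 / real K) ^ K \<le> exp (- (1 / real K)) ^ K"
    using exp_ge_add_one_self[of "- (1 / real K)"] assms by (intro power_mono) auto
  also have "\<dots> = exp (- 1)"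
    using assms by (simp add: exp_of_nat_mult[symmetric])
  also have "\<dots> \<le> 1 / 2"
    using exp_ge_add_one_self[of 1] by (simp add: exp_minus field_simps)
  finally show ?thesis .
qed

lemma one_plus_inverse_power_le:
  assumes "K \<ge> (1::nat)"
  shows "(1 + 1 / real K) ^ K \<le> 4"
proof -
  have "(1 + 1 / real K) ^ K \<le> exp (1 / real K) ^ K"
    using exp_ge_add_one_self[of "1 / real K"] by (intro power_mono) auto
  also have "\<dots> = exp 1"
    using assms by (simp add: exp_of_nat_mult[symmetric])
  also have "\<dots> \<le> 4" using exp_le by simp
  finally show ?thesis .
qed

text \<open>Realises the geometric distribution by a uniform choice among \<open>2 ^ m\<close>
  values. The upper half gets level 0 and the lower half is treated recursively; the counts add up
  to \<open>2 ^ m - 1\<close>, so one value has no level below \<open>m\<close>.\<close>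

lemma exists_geometric_levels:
  "\<exists>lv :: nat \<Rightarrow> nat. \<forall>i<m. card {x \<in> {..<2 ^ m}. lv x = i} = 2 ^ (m - 1 - i)"
proof (induction m)
  case 0
  then show ?case by simp
next
  case (Suc m)
  then obtain lv :: "nat \<Rightarrow> nat" where lv: "\<forall>i<m. card {x \<in> {..<2 ^ m}. lv x = i} = 2 ^ (m - 1 - i)"
    by blast
  define lv' where "lv' x = (if x < 2 ^ m then Suc (lv x) else 0)" for x :: nat
  have "card {x \<in> {..<2 ^ Suc m}. lv' x = i} = 2 ^ (Suc m - 1 - i)" if "i < Suc m" for i
  proof (cases i)
    case 0
    have "{x \<in> {..<2 ^ Suc m}. lv' x = i} = {2 ^ m..<2 ^ Suc m}"
      by (auto simp: lv'_def 0)
    then show ?thesis by (simp add: 0)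
  next
    case (Suc j)
    have "{x \<in> {..<2 ^ Suc m}. lv' x = i} = {x \<in> {..<2 ^ m}. lv x = j}"
      by (auto simp: lv'_def Suc)
    then show ?thesis using lv that by (simp add: Suc)
  qed
  then show ?case by blast
qed

text \<open>The term \<open>2 * (d div 2 ^ m)\<close> strengthens the induction: it pays for the
  next summand and for its own successor.\<close>

lemma sum_div_power2_le: "(\<Sum>i<m. d div 2 ^ i) + 2 * (d div 2 ^ m) \<le> 2 * (d :: nat)"
proof (induction m)
  case 0
  then show ?case by simp
next
  case (Suc m)
  have "2 * (d div 2 ^ Suc m) \<le> d div 2 ^ m"
    by (simp add: div_mult2_eq power_Suc2 del: power_Suc)
  with Suc show ?case by simp
qed

section \<open>Levels and colours\<close>

text \<open>\<open>H\<close> is the conflict relation; degrees from \<open>8 * t\<close> on count as large.\<close>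

locale nbhd_system =
  fixes V :: "'a set" and N H :: "'a \<Rightarrow> 'a set" and m d t :: nat
  assumes finite_V: "finite V"
    and N_sub: "N v \<subseteq> V"
    and N_sym: "u \<in> N v \<Longrightarrow> v \<in> N u"
    and card_N: "card (N v) \<le> 2 ^ m"
    and m_pos: "1 \<le> m"
    and H_sub: "H u \<subseteq> (\<Union>w\<in>N u. N w)"
    and card_H: "card (H u) \<le> d"
    and H_sym: "u \<in> H w \<Longrightarrow> w \<in> H u"
    and H_irrefl: "u \<notin> H u"
    and t_large: "14 * m \<le> t"
begin

lemma finite_N: "finite (N v)"
  using N_sub finite_V finite_subset by blast

lemma H_subset_V: "H u \<subseteq> V"
  using H_sub N_sub by blast

lemma finite_H: "finite (H u)"
  using H_subset_V finite_V finite_subset by blast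

text \<open>Vertices reached by walks of one to three steps. The events at \<open>v\<close> read
  \<open>N v\<close>, \<open>H v\<close> and \<open>H u\<close> for \<open>u \<in> N v\<close>, and
  \<open>H\<close> spans two steps.\<close>

definition ball3 :: "'a \<Rightarrow> 'a set" where
  "ball3 v = N v \<union> (\<Union>w\<in>N v. N w) \<union> (\<Union>w\<in>N v. \<Union>x\<in>N w. N x)"

lemma ball3_sub: "ball3 v \<subseteq> V"
  unfolding ball3_def using N_sub by blast

lemma ball3_sym: "u \<in> ball3 v \<Longrightarrow> v \<in> ball3 u"
  unfolding ball3_def using N_sym by (simp, blast)

lemma card_ball3: "card (ball3 v) \<le> 2 ^ (3 * m + 2)"
proof -
  have step: "card (\<Union>w\<in>N v. Z w) \<le> 2 ^ m * c" if "\<And>w. card (Z w) \<le> c" for v c and Z :: "'a \<Rightarrow> 'a set"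
  proof -
    have "card (\<Union>w\<in>N v. Z w) \<le> (\<Sum>w\<in>N v. card (Z w))" by (rule card_UN_le[OF finite_N])
    also have "\<dots> \<le> of_nat (card (N v)) * c" using that by (intro sum_bounded_above) auto
    also have "\<dots> \<le> 2 ^ m * c" using card_N by simp
    finally show ?thesis .
  qed
  have 2: "card (\<Union>w\<in>N v. N w) \<le> 2 ^ m * 2 ^ m" for v by (rule step[OF card_N])
  have 3: "card (\<Union>w\<in>N v. \<Union>x\<in>N w. N x) \<le> 2 ^ m * (2 ^ m * 2 ^ m)" by (rule step[OF 2])
  have "card (ball3 v) \<le> card (N v) + card (\<Union>w\<in>N v. N w) + card (\<Union>w\<in>N v. \<Union>x\<in>N w. N x)"
    unfolding ball3_def by (meson card_Un_le order_trans add_right_mono)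
  also have "\<dots> \<le> 2 ^ m + 2 ^ m * 2 ^ m + 2 ^ m * (2 ^ m * 2 ^ m)"
    using card_N 2 3 by (intro add_mono)
  also have "\<dots> = 2 ^ m + 2 ^ (2 * m) + 2 ^ (3 * m)"
    by (simp add: power_add[symmetric] mult_2)
  also have "\<dots> \<le> 2 ^ (3 * m) + 2 ^ (3 * m) + 2 ^ (3 * m)"
    by (intro add_mono power_increasing) auto
  also have "\<dots> \<le> 2 ^ (3 * m + 2)" by (simp add: power_add)
  finally show ?thesis .
qed

lemma subset_ball3:
  "N v \<subseteq> ball3 v" "H v \<subseteq> ball3 v" "u \<in> N v \<Longrightarrow> H u \<subseteq> ball3 v"
proof -
  show "N v \<subseteq> ball3 v" "H v \<subseteq> ball3 v" using H_sub[of v] by (auto simp: ball3_def)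
  assume "u \<in> N v"
  then have "(\<Union>w\<in>N u. N w) \<subseteq> ball3 v" by (auto simp: ball3_def)
  then show "H u \<subseteq> ball3 v" using H_sub[of u] by (rule order_trans[rotated])
qed

text \<open>Merges the events of all levels at one vertex. The hypothesis \<open>prob\<close> leaves
  room for three failures of probability \<open>2 ^ -t\<close> per level; the union has probability
  at most \<open>3 * m * 2 ^ -t \<le> 2 ^ (2 * m - t)\<close>.\<close>

lemma local_lemma:
  fixes A :: "'a \<Rightarrow> nat \<Rightarrow> ('a \<Rightarrow> 'b) \<Rightarrow> bool"
  assumes B: "\<And>u. u \<in> V \<Longrightarrow> finite (B u)" "\<And>u. u \<in> V \<Longrightarrow> B u \<noteq> {}"
    and dep: "\<And>v i r r'. (\<forall>u\<in>ball3 v. r u = r' u) \<Longrightarrow> A v i r \<Longrightarrow> A v i r'"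
    and prob: "\<And>v i. v \<in> V \<Longrightarrow> i < m \<Longrightarrow> 2 ^ t * card {r \<in> PiE V B. A v i r} \<le> 3 * card (PiE V B)"
  shows "\<exists>r\<in>PiE V B. \<forall>v\<in>V. \<forall>i<m. \<not> A v i r"
proof -
  define A' where "A' v r \<longleftrightarrow> (\<exists>i<m. A v i r)" for v r
  have "\<exists>r\<in>PiE V B. \<forall>v\<in>V. \<not> A' v r"
  proof (rule lovasz_local_product[where S = ball3 and D = "2 ^ (3 * m + 2)"])
    show "A' v r \<longleftrightarrow> A' v r'" if "\<forall>u\<in>ball3 v. r u = r' u" for v r r'
      unfolding A'_def using dep[of v r r'] dep[of v r' r] that by auto
    show "card {i \<in> V. u \<in> ball3 i} \<le> 2 ^ (3 * m + 2)" for u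
    proof -
      have "{i \<in> V. u \<in> ball3 i} \<subseteq> ball3 u" using ball3_sym by blast
      moreover have "finite (ball3 u)" using ball3_sub finite_V finite_subset by blast
      ultimately show ?thesis using card_ball3 card_mono order_trans by blast
    qed
    fix v assume v: "v \<in> V"
    let ?bad = "{r \<in> PiE V B. A' v r}"
    have "?bad = (\<Union>i<m. {r \<in> PiE V B. A v i r})" by (auto simp: A'_def)
    then have "card ?bad \<le> (\<Sum>i<m. card {r \<in> PiE V B. A v i r})"
      using card_UN_le[of "{..<m}"] by simp
    then have "2 ^ t * card ?bad \<le> (\<Sum>i<m. 2 ^ t * card {r \<in> PiE V B. A v i r})"
      by (simp add: sum_distrib_left[symmetric])
    also have "\<dots> \<le> of_nat (card {..<m}) * (3 * card (PiE V B))"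
      using prob[OF v] by (intro sum_bounded_above) auto
    finally have 1: "2 ^ t * card ?bad \<le> 3 * m * card (PiE V B)" by simp
    have "3 * m \<le> 4 ^ m"
      using m_pos by (induction m rule: dec_induct) auto
    then have "3 * m * card (PiE V B) \<le> 2 ^ (2 * m) * card (PiE V B)"
      by (simp add: power_mult)
    with 1 have "2 ^ t * card ?bad \<le> 2 ^ (2 * m) * card (PiE V B)" by linarith
    \<comment> \<open>Origin of the constant 14: \<open>2 * m + (6 * m + 6) \<le> 14 * m\<close> for
      \<open>m \<ge> 1\<close>, where \<open>2 ^ (6 * m + 6)\<close> is four times the squared bound
      on \<open>ball3\<close>.\<close>
    moreover have "(2::nat) ^ (2 * m) * 2 ^ (6 * m + 6) \<le> 2 ^ t"
      unfolding power_add[symmetric] using t_large m_pos by (intro power_increasing) auto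
    then have "2 ^ (2 * m) * 2 ^ (6 * m + 6) * card ?bad \<le> 2 ^ t * card ?bad"
      by (intro mult_right_mono) auto
    ultimately have "2 ^ (2 * m) * 2 ^ (6 * m + 6) * card ?bad \<le> 2 ^ (2 * m) * card (PiE V B)"
      by (rule order_trans[rotated])
    then have "2 ^ (6 * m + 6) * card ?bad \<le> card (PiE V B)"
      unfolding mult.assoc by simp
    moreover have "4 * (2 ^ (3 * m + 2))\<^sup>2 = (2::nat) ^ (6 * m + 6)"
      by (simp add: power_mult[symmetric] power_add)
    ultimately show "4 * (2 ^ (3 * m + 2))\<^sup>2 * card ?bad \<le> card (PiE V B)" by simp
  qed (use finite_V B ball3_sub card_ball3 in auto)
  then show ?thesis by (auto simp: A'_def)
qed

section \<open>Random levels\<close>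

text \<open>Level \<open>i\<close> has probability \<open>2 ^ -(i + 1)\<close>, so such a
  \<open>v\<close> expects between \<open>4 * t\<close> and \<open>8 * t\<close> neighbours of level
  \<open>i\<close>.\<close>

definition in_level_range :: "'a \<Rightarrow> nat \<Rightarrow> bool" where
  "in_level_range v i \<longleftrightarrow> 8 * t * 2 ^ i \<le> card (N v) \<and> card (N v) \<le> 8 * t * 2 ^ Suc i"

text \<open>Three failures of probability at most \<open>2 ^ -t\<close> each: fewer than
  \<open>t\<close> neighbours where at least \<open>4 * t\<close> are expected, more than
  \<open>32 * t\<close> where at most \<open>8 * t\<close> are expected, and too many conflicts. In
  the last bound \<open>8 * t\<close> secures concentration when \<open>d div 2 ^ i\<close> is
  small.\<close>

lemma levels_exist:
  "\<exists>lev :: 'a \<Rightarrow> nat. \<forall>v\<in>V. \<forall>i<m.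
     (in_level_range v i \<longrightarrow>
        t \<le> card {u \<in> N v. lev u = i} \<and> card {u \<in> N v. lev u = i} \<le> 32 * t) \<and>
     card {w \<in> H v. lev w = i} \<le> 2 * (d div 2 ^ i + 1) + 8 * t"
proof -
  obtain lv :: "nat \<Rightarrow> nat" where lv: "\<And>i. i < m \<Longrightarrow> card {x \<in> {..<2 ^ m}. lv x = i} = 2 ^ (m - 1 - i)"
    using exists_geometric_levels[of m] by blast
  define B where "B = (\<lambda>u::'a. {..<(2::nat) ^ m})"
  define Y where "Y i = {x. lv x = i}" for i
  let ?\<Omega> = "PiE V B"
  have BY: "real (card (B u \<inter> Y i)) = 1 / 2 ^ Suc i * real (card (B u))" if "i < m" for u i
  proof -
    have "B u \<inter> Y i = {x \<in> {..<2 ^ m}. lv x = i}" by (auto simp: B_def Y_def)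
    then have "card (B u \<inter> Y i) = 2 ^ (m - 1 - i)" using lv[OF that] by simp
    moreover have "(2::real) ^ m = 2 ^ (m - 1 - i) * 2 ^ Suc i"
      unfolding power_add[symmetric] using that by simp
    ultimately show ?thesis by (simp add: B_def)
  qed
  have B: "finite (B u)" "B u \<noteq> {}" for u by (auto simp: B_def lessThan_empty_iff)
  have fin\<Omega>: "finite ?\<Omega>" using finite_V B by (intro finite_PiE) auto
  \<comment> \<open>The moment for \<open>z = 2\<close> is at most
    \<open>(1 + 2 ^ -(i + 1)) ^ card T\<close>, and each block of \<open>2 ^ (i + 1)\<close> factors
    contributes at most 4.\<close>
  have upper: "2 ^ n * real (card {r \<in> ?\<Omega>. n \<le> card {u \<in> T. r u \<in> Y i}}) \<le> 4 ^ c * real (card ?\<Omega>)"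
    if "i < m" "T \<subseteq> V" "card T \<le> 2 ^ Suc i * c" for i n c T
  proof -
    have "2 ^ n * real (card {r \<in> ?\<Omega>. n \<le> card {u \<in> T. r u \<in> Y i}})
        \<le> (1 + (2 - 1) * (1 / 2 ^ Suc i)) ^ card T * real (card ?\<Omega>)"
      by (rule count_tail[OF finite_V B]) (use that BY in auto)
    also have "(1 + (2 - 1) * (1 / 2 ^ Suc i)) ^ card T \<le> (1 + 1 / real (2 ^ Suc i)) ^ (2 ^ Suc i * c)"
      using that(3) by (auto intro: power_increasing)
    also have "\<dots> \<le> 4 ^ c"
      unfolding power_mult using one_plus_inverse_power_le[of "2 ^ Suc i"] by (intro power_mono) auto
    finally show ?thesis by (simp add: mult_right_mono)
  qed
  \<comment> \<open>A lower tail is an upper tail for the misses. For \<open>z = 2\<close> the base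
    is \<open>2 - 2 ^ -(i + 1) = 2 * (1 - x)\<close>. The powers of 2 leave a loss of
    \<open>2 ^ t\<close>, while \<open>n \<ge> 2 ^ (i + 2) * (2 * t)\<close> makes
    \<open>(1 - x) ^ n\<close> at most \<open>2 ^ -(2 * t)\<close>.\<close>
  have lower: "2 ^ t * real (card {r \<in> ?\<Omega>. card {u \<in> N v. r u \<in> Y i} < t}) \<le> real (card ?\<Omega>)"
    if i: "i < m" and large: "8 * t * 2 ^ i \<le> card (N v)" for v i
  proof -
    define n where "n = card (N v)"
    define x :: real where "x = 1 / real (2 ^ Suc (Suc i))"
    \<comment> \<open>Ensures that the subtraction \<open>n - t\<close> below is not
      truncated.\<close>
    have tn: "t \<le> n"
    proof -
      have "t * 1 \<le> t * (8 * 2 ^ i)" by (intro mult_left_mono) auto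
      also have "\<dots> \<le> n" using large by (simp add: n_def mult_ac)
      finally show ?thesis by simp
    qed
    let ?miss = "{r \<in> ?\<Omega>. n - t \<le> card {u \<in> N v. r u \<in> - Y i}}"
    have "card (B u \<inter> - Y i) = card (B u) - card (B u \<inter> Y i)" for u
      using B card_Diff_subset_Int[of "B u" "Y i"] by (simp add: Diff_eq)
    moreover have "card (B u \<inter> Y i) \<le> card (B u)" for u using B by (intro card_mono) auto
    ultimately have "real (card (B u \<inter> - Y i)) = (1 - 1 / 2 ^ Suc i) * real (card (B u))" for u
      using BY[OF i, of u] by (simp add: of_nat_diff algebra_simps)
    then have "2 ^ (n - t) * real (card ?miss)
        \<le> (1 + (2 - 1) * (1 - 1 / 2 ^ Suc i)) ^ card (N v) * real (card ?\<Omega>)"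
      by (intro count_tail[OF finite_V B]) (use N_sub one_le_power[of "2::real" "Suc i"] in auto)
    also have "1 + (2 - 1) * (1 - 1 / 2 ^ Suc i) = 2 * (1 - x)"
      by (simp add: x_def)
    also have "(2 * (1 - x)) ^ card (N v) = 2 ^ (n - t) * (2 ^ t * (1 - x) ^ n)"
    proof -
      have "(2::real) ^ n = 2 ^ (n - t) * 2 ^ t" using tn by (simp add: power_add[symmetric])
      then show ?thesis unfolding n_def[symmetric] by (simp only: power_mult_distrib mult.assoc)
    qed
    finally have "2 ^ (n - t) * real (card ?miss)
        \<le> 2 ^ (n - t) * (2 ^ t * (1 - x) ^ n * real (card ?\<Omega>))"
      by (simp only: mult.assoc)
    then have 1: "real (card ?miss) \<le> 2 ^ t * (1 - x) ^ n * real (card ?\<Omega>)"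
      by (rule mult_left_le_imp_le) simp
    have "(1 - x) ^ n \<le> (1 - x) ^ (2 ^ Suc (Suc i) * (2 * t))"
      using large one_le_power[of "2::real" "Suc (Suc i)"]
      by (intro power_decreasing) (auto simp: n_def x_def mult_ac)
    also have "\<dots> \<le> (1 / 2) ^ (2 * t)"
      unfolding power_mult x_def using one_minus_inverse_power_le[of "2 ^ Suc (Suc i)"]
        one_le_power[of "2::real" "Suc (Suc i)"]
      by (intro power_mono zero_le_power) auto
    finally have "2 ^ t * (1 - x) ^ n * real (card ?\<Omega>) \<le> 2 ^ t * (1 / 2) ^ (2 * t) * real (card ?\<Omega>)"
      by (intro mult_right_mono mult_left_mono) auto
    with 1 have "real (card ?miss) \<le> 2 ^ t * (1 / 2) ^ (2 * t) * real (card ?\<Omega>)" by linarith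
    then have "2 ^ t * real (card ?miss) \<le> 2 ^ t * (2 ^ t * (1 / 2) ^ (2 * t) * real (card ?\<Omega>))"
      by (intro mult_left_mono) auto
    also have "\<dots> = real (card ?\<Omega>)"
      by (simp add: power_mult power_one_over mult_2 power_add power2_eq_square field_simps)
    finally have 2: "2 ^ t * real (card ?miss) \<le> real (card ?\<Omega>)" .
    have "{r \<in> ?\<Omega>. card {u \<in> N v. r u \<in> Y i} < t} \<subseteq> ?miss"
    proof clarify
      fix r assume lt: "card {u \<in> N v. r u \<in> Y i} < t"
      have "{u \<in> N v. r u \<in> - Y i} = N v - {u \<in> N v. r u \<in> Y i}" by auto
      then have "card {u \<in> N v. r u \<in> - Y i} = n - card {u \<in> N v. r u \<in> Y i}"
        unfolding n_def using finite_N by (simp add: card_Diff_subset)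
      then show "n - t \<le> card {u \<in> N v. r u \<in> - Y i}" using lt by linarith
    qed
    then have "card {r \<in> ?\<Omega>. card {u \<in> N v. r u \<in> Y i} < t} \<le> card ?miss"
      using fin\<Omega> by (intro card_mono) auto
    then have "2 ^ t * real (card {r \<in> ?\<Omega>. card {u \<in> N v. r u \<in> Y i} < t}) \<le> 2 ^ t * real (card ?miss)"
      by simp
    with 2 show ?thesis by linarith
  qed
  define few where "few v i r \<longleftrightarrow> in_level_range v i \<and> card {u \<in> N v. r u \<in> Y i} < t" for v i r
  define many where "many v i r \<longleftrightarrow> in_level_range v i \<and> 32 * t < card {u \<in> N v. r u \<in> Y i}" for v i r
  define crowded where "crowded v i r \<longleftrightarrow>
      2 * (d div 2 ^ i + 1) + 8 * t < card {w \<in> H v. r w \<in> Y i}" for v i r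
  have few: "2 ^ t * real (card {r \<in> ?\<Omega>. few v i r}) \<le> real (card ?\<Omega>)" if "i < m" for v i
    using lower[OF that, of v] by (cases "in_level_range v i") (auto simp: few_def in_level_range_def)
  have many: "2 ^ t * real (card {r \<in> ?\<Omega>. many v i r}) \<le> real (card ?\<Omega>)" if "i < m" for v i
  proof (cases "in_level_range v i")
    case True
    have "2 ^ (32 * t) * real (card {r \<in> ?\<Omega>. 32 * t \<le> card {u \<in> N v. r u \<in> Y i}})
        \<le> 4 ^ (8 * t) * real (card ?\<Omega>)"
      using True by (intro upper[OF that N_sub]) (simp add: in_level_range_def mult_ac)
    moreover have "card {r \<in> ?\<Omega>. many v i r} \<le> card {r \<in> ?\<Omega>. 32 * t \<le> card {u \<in> N v. r u \<in> Y i}}"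
      using fin\<Omega> by (intro card_mono) (auto simp: many_def)
    then have "2 ^ (32 * t) * real (card {r \<in> ?\<Omega>. many v i r})
        \<le> 2 ^ (32 * t) * real (card {r \<in> ?\<Omega>. 32 * t \<le> card {u \<in> N v. r u \<in> Y i}})" by simp
    moreover have "(4::real) ^ (8 * t) * 2 ^ t \<le> 2 ^ (32 * t)"
    proof -
      have "(4::real) ^ (8 * t) = 2 ^ (16 * t)" using power_mult[of "2::real" 2 "8 * t"] by simp
      then have "(4::real) ^ (8 * t) * 2 ^ t = 2 ^ (16 * t + t)" by (simp only: power_add)
      also have "\<dots> \<le> 2 ^ (32 * t)" by (intro power_increasing) auto
      finally show ?thesis .
    qed
    then have "4 ^ (8 * t) * 2 ^ t * real (card {r \<in> ?\<Omega>. many v i r})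
        \<le> 2 ^ (32 * t) * real (card {r \<in> ?\<Omega>. many v i r})"
      by (intro mult_right_mono) auto
    ultimately have "4 ^ (8 * t) * (2 ^ t * real (card {r \<in> ?\<Omega>. many v i r}))
        \<le> 4 ^ (8 * t) * real (card ?\<Omega>)"
      unfolding mult.assoc[symmetric] by linarith
    then show ?thesis by (rule mult_left_le_imp_le) simp
  qed (simp add: many_def)
  have crowded: "2 ^ t * real (card {r \<in> ?\<Omega>. crowded v i r}) \<le> real (card ?\<Omega>)" if "i < m" for v i
  proof -
    \<comment> \<open>The \<open>+ 1\<close> compensates for rounding down and gives
      \<open>d \<le> 2 ^ i * g\<close>. In the tail, \<open>2 ^ (2 * g)\<close> cancels the moment
      \<open>4 ^ g\<close> and \<open>2 ^ (8 * t)\<close> remains.\<close>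
    define g where "g = d div 2 ^ i + 1"
    have "d \<le> 2 ^ i * g"
      unfolding g_def using dividend_less_times_div[of "2 ^ i" d] by (simp add: distrib_left)
    then have "card (H v) \<le> 2 ^ Suc i * g" using card_H[of v] by simp
    then have "2 ^ (2 * g + 8 * t) * real (card {r \<in> ?\<Omega>. 2 * g + 8 * t \<le> card {u \<in> H v. r u \<in> Y i}})
        \<le> 4 ^ g * real (card ?\<Omega>)"
      by (intro upper[OF that H_subset_V])
    also have "(4::real) ^ g = 2 ^ (2 * g)" by (simp add: power_mult)
    finally have "2 ^ (2 * g) * (2 ^ (8 * t) * real (card {r \<in> ?\<Omega>. 2 * g + 8 * t \<le> card {u \<in> H v. r u \<in> Y i}}))
        \<le> 2 ^ (2 * g) * real (card ?\<Omega>)" by (simp only: power_add mult.assoc)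
    then have 1: "2 ^ (8 * t) * real (card {r \<in> ?\<Omega>. 2 * g + 8 * t \<le> card {u \<in> H v. r u \<in> Y i}})
        \<le> real (card ?\<Omega>)" by (rule mult_left_le_imp_le) simp
    have "card {r \<in> ?\<Omega>. crowded v i r} \<le> card {r \<in> ?\<Omega>. 2 * g + 8 * t \<le> card {u \<in> H v. r u \<in> Y i}}"
      using fin\<Omega> by (intro card_mono) (auto simp: crowded_def g_def)
    then have "2 ^ t * real (card {r \<in> ?\<Omega>. crowded v i r})
        \<le> 2 ^ (8 * t) * real (card {r \<in> ?\<Omega>. 2 * g + 8 * t \<le> card {u \<in> H v. r u \<in> Y i}})"
      by (intro mult_mono power_increasing) auto
    with 1 show ?thesis by linarith
  qed
  have "\<exists>r\<in>?\<Omega>. \<forall>v\<in>V. \<forall>i<m. \<not> (few v i r \<or> many v i r \<or> crowded v i r)"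
  proof (rule local_lemma[OF B])
    fix v i and r r' :: "'a \<Rightarrow> nat"
    assume agree: "\<forall>u\<in>ball3 v. r u = r' u"
    have "{u \<in> N v. r u \<in> Y i} = {u \<in> N v. r' u \<in> Y i}"
      using agree subset_ball3(1)[of v] by auto
    moreover have "{u \<in> H v. r u \<in> Y i} = {u \<in> H v. r' u \<in> Y i}"
      using agree subset_ball3(2)[of v] by auto
    ultimately show "few v i r \<or> many v i r \<or> crowded v i r \<Longrightarrow> few v i r' \<or> many v i r' \<or> crowded v i r'"
      by (simp add: few_def many_def crowded_def)
  next
    fix v i assume i: "i < m"
    have "{r \<in> ?\<Omega>. few v i r \<or> many v i r \<or> crowded v i r}
        = {r \<in> ?\<Omega>. few v i r} \<union> {r \<in> ?\<Omega>. many v i r} \<union> {r \<in> ?\<Omega>. crowded v i r}" by auto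
    from arg_cong[OF this, where f = card]
    have "card {r \<in> ?\<Omega>. few v i r \<or> many v i r \<or> crowded v i r}
        \<le> card {r \<in> ?\<Omega>. few v i r} + card {r \<in> ?\<Omega>. many v i r} + card {r \<in> ?\<Omega>. crowded v i r}"
      using order_trans[OF card_Un_le add_right_mono[OF card_Un_le]] by (rule ord_eq_le_trans)
    then have "real (card {r \<in> ?\<Omega>. few v i r \<or> many v i r \<or> crowded v i r})
        \<le> real (card {r \<in> ?\<Omega>. few v i r}) + real (card {r \<in> ?\<Omega>. many v i r}) + real (card {r \<in> ?\<Omega>. crowded v i r})"
      unfolding of_nat_add[symmetric] of_nat_le_iff .
    then have "2 ^ t * real (card {r \<in> ?\<Omega>. few v i r \<or> many v i r \<or> crowded v i r})
        \<le> 2 ^ t * (real (card {r \<in> ?\<Omega>. few v i r}) + real (card {r \<in> ?\<Omega>. many v i r}) + real (card {r \<in> ?\<Omega>. crowded v i r}))"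
      by (intro mult_left_mono) auto
    also have "\<dots> \<le> 3 * real (card ?\<Omega>)"
      using few[OF i, of v] many[OF i, of v] crowded[OF i, of v] unfolding distrib_left by linarith
    finally have "real (2 ^ t * card {r \<in> ?\<Omega>. few v i r \<or> many v i r \<or> crowded v i r}) \<le> real (3 * card ?\<Omega>)"
      by simp
    then show "2 ^ t * card {r \<in> ?\<Omega>. few v i r \<or> many v i r \<or> crowded v i r} \<le> 3 * card ?\<Omega>"
      unfolding of_nat_le_iff .
  qed
  then obtain r where "\<forall>v\<in>V. \<forall>i<m. \<not> (few v i r \<or> many v i r \<or> crowded v i r)" by blast
  then have "\<forall>v\<in>V. \<forall>i<m. (in_level_range v i \<longrightarrow>
        t \<le> card {u \<in> N v. lv (r u) = i} \<and> card {u \<in> N v. lv (r u) = i} \<le> 32 * t) \<and>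
     card {w \<in> H v. lv (r w) = i} \<le> 2 * (d div 2 ^ i + 1) + 8 * t"
    by (simp add: few_def many_def crowded_def Y_def not_less)
  then show ?thesis by (intro exI[where x = "\<lambda>u. lv (r u)"])
qed

section \<open>Random colours within the levels\<close>

text \<open>\<open>Q i\<close> is 16 times the sum of the bound on conflicts at level
  \<open>i\<close> and the bound \<open>32 * t\<close> on neighbours there, as
  \<open>monochromatic_tail\<close> requires; at least \<open>t\<close> such neighbours make failure
  as rare as \<open>2 ^ -t\<close>. The witness also differs from its conflicts so that it survives
  the later recolouring.\<close>

lemma colours_exist:
  assumes lev: "\<And>v i. v \<in> V \<Longrightarrow> i < m \<Longrightarrow> in_level_range v i \<Longrightarrow>
        t \<le> card {u \<in> N v. lev u = i} \<and> card {u \<in> N v. lev u = i} \<le> 32 * t"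
    and crowd: "\<And>v i. v \<in> V \<Longrightarrow> i < m \<Longrightarrow> card {w \<in> H v. lev w = i} \<le> 2 * (d div 2 ^ i + 1) + 8 * t"
    and Q: "\<And>i. Q i = 16 * (2 * (d div 2 ^ i + 1) + 40 * t)"
  shows "\<exists>r :: 'a \<Rightarrow> nat. (\<forall>u\<in>V. r u < Q (lev u)) \<and>
    (\<forall>v\<in>V. \<forall>i<m. in_level_range v i \<longrightarrow> (\<exists>u\<in>N v. lev u = i \<and>
       (\<forall>w\<in>H u \<union> N v - {u}. lev w = i \<longrightarrow> r w \<noteq> r u)))"
proof -
  define B where "B u = {..<Q (lev u)}" for u
  have B: "finite (B u)" "B u \<noteq> {}" for u by (auto simp: B_def Q lessThan_empty_iff)
  define C where "C i u = {w \<in> H u. lev w = i}" for i u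
  define X where "X v i = {u \<in> N v. lev u = i}" for v i
  define bad where "bad v i r \<longleftrightarrow> in_level_range v i \<and> (\<forall>u\<in>X v i. \<exists>w\<in>C i u \<union> X v i - {u}. r w = r u)"
    for v i and r :: "'a \<Rightarrow> nat"
  let ?\<Omega> = "PiE V B"
  have "\<exists>r\<in>?\<Omega>. \<forall>v\<in>V. \<forall>i<m. \<not> bad v i r"
  proof (rule local_lemma[OF B])
    fix v i and r r' :: "'a \<Rightarrow> nat"
    assume agree: "\<forall>u\<in>ball3 v. r u = r' u" and "bad v i r"
    have "r u = r' u" if "u \<in> N v" for u using that agree subset_ball3(1)[of v] by auto
    moreover have "r w = r' w" if "u \<in> N v" "w \<in> H u" for u w
      using that agree subset_ball3(3)[of u v] by auto
    ultimately have "r u = r' u" "w \<in> C i u \<union> X v i - {u} \<Longrightarrow> r w = r' w" if "u \<in> X v i" for u w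
      using that by (auto simp: X_def C_def)
    note same = this
    show "bad v i r'" unfolding bad_def
    proof (intro conjI ballI)
      show "in_level_range v i" using \<open>bad v i r\<close> by (simp add: bad_def)
      fix u assume u: "u \<in> X v i"
      obtain w where "w \<in> C i u \<union> X v i - {u}" "r w = r u"
        using \<open>bad v i r\<close> u unfolding bad_def by blast
      then show "\<exists>w\<in>C i u \<union> X v i - {u}. r' w = r' u"
        using same[OF u] by (intro bexI[of _ w]) auto
    qed
  next
    fix v i assume v: "v \<in> V" and i: "i < m"
    show "2 ^ t * card {r \<in> ?\<Omega>. bad v i r} \<le> 3 * card ?\<Omega>"
    proof (cases "in_level_range v i")
      case True
      have X: "t \<le> card (X v i)" "card (X v i) \<le> 32 * t" using lev[OF v i True] by (auto simp: X_def)
      have XV: "X v i \<subseteq> V" using N_sub by (auto simp: X_def)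
      have "2 ^ card (X v i) * card {r \<in> ?\<Omega>. \<forall>u\<in>X v i. \<exists>w\<in>C i u \<union> X v i - {u}. r w = r u} \<le> card ?\<Omega>"
      proof (rule monochromatic_tail[OF finite_V B XV])
        fix u assume u: "u \<in> X v i"
        show "finite (C i u)" using finite_H by (simp add: C_def)
        have "u \<in> V" "lev u = i" using u XV by (auto simp: X_def)
        then have "card (C i u) \<le> 2 * (d div 2 ^ i + 1) + 8 * t"
          using crowd i by (simp add: C_def)
        then show "16 * card (C i u \<union> X v i) \<le> card (B u)"
          using card_Un_le[of "C i u" "X v i"] X \<open>lev u = i\<close> by (simp add: B_def Q)
      qed
      then have "2 ^ card (X v i) * card {r \<in> ?\<Omega>. bad v i r} \<le> card ?\<Omega>"
        using True by (simp add: bad_def)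
      moreover have "2 ^ t * card {r \<in> ?\<Omega>. bad v i r} \<le> 2 ^ card (X v i) * card {r \<in> ?\<Omega>. bad v i r}"
        using X by (intro mult_right_mono power_increasing) auto
      ultimately show ?thesis by linarith
    qed (simp add: bad_def)
  qed
  then obtain r where r: "r \<in> ?\<Omega>" "\<forall>v\<in>V. \<forall>i<m. \<not> bad v i r" by blast
  have "\<forall>u\<in>V. r u < Q (lev u)" using r(1) by (auto simp: B_def PiE_iff)
  moreover have "\<exists>u\<in>N v. lev u = i \<and> (\<forall>w\<in>H u \<union> N v - {u}. lev w = i \<longrightarrow> r w \<noteq> r u)"
    if "v \<in> V" "i < m" "in_level_range v i" for v i
  proof -
    have "\<not> bad v i r" using r(2) that by blast
    then obtain u where u: "u \<in> X v i" "\<forall>w\<in>C i u \<union> X v i - {u}. r w \<noteq> r u"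
      using \<open>in_level_range v i\<close> unfolding bad_def by blast
    then show ?thesis by (intro bexI[of _ u]) (auto simp: X_def C_def)
  qed
  ultimately show ?thesis by blast
qed

section \<open>Recolouring and assembly\<close>

text \<open>Greedy colouring: the conflicts of a new vertex block at most \<open>d\<close> of the
  \<open>d + 1\<close> colours.\<close>

lemma proper_colouring:
  "\<exists>\<phi> :: 'a \<Rightarrow> nat. (\<forall>u\<in>V. \<phi> u \<le> d) \<and> (\<forall>u\<in>V. \<forall>w\<in>H u. \<phi> u \<noteq> \<phi> w)"
proof -
  have "\<exists>\<phi> :: 'a \<Rightarrow> nat. (\<forall>u\<in>W. \<phi> u \<le> d) \<and> (\<forall>u\<in>W. \<forall>w\<in>H u \<inter> W. \<phi> u \<noteq> \<phi> w)" if "W \<subseteq> V" for W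
    using finite_subset[OF that finite_V]
  proof (induction W rule: finite_induct)
    case empty
    then show ?case by simp
  next
    case (insert x W)
    then obtain \<phi> :: "'a \<Rightarrow> nat" where \<phi>: "\<forall>u\<in>W. \<phi> u \<le> d" "\<forall>u\<in>W. \<forall>w\<in>H u \<inter> W. \<phi> u \<noteq> \<phi> w"
      by blast
    have "card (\<phi> ` (H x)) < card {..d}"
      using card_image_le[OF finite_H, of \<phi> x] card_H[of x] by simp
    then have "\<not> {..d} \<subseteq> \<phi> ` H x" using card_mono[of "\<phi> ` H x" "{..d}"] finite_H[of x] by auto
    then obtain c where c: "c \<le> d" "c \<notin> \<phi> ` H x" by auto
    have "\<forall>u\<in>insert x W. \<forall>w\<in>H u \<inter> insert x W. (\<phi>(x := c)) u \<noteq> (\<phi>(x := c)) w"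
    proof (intro ballI)
      fix u w assume uw: "u \<in> insert x W" "w \<in> H u \<inter> insert x W"
      then have "u \<noteq> w" "u \<in> H w" using H_irrefl[of u] H_sym[of w u] by auto
      consider "u = x" | "w = x" | "u \<noteq> x" "w \<noteq> x" by blast
      then show "(\<phi>(x := c)) u \<noteq> (\<phi>(x := c)) w"
      proof cases
        case 1
        then show ?thesis using uw c(2) \<open>u \<noteq> w\<close> by auto
      next
        case 2
        then show ?thesis using \<open>u \<in> H w\<close> c(2) \<open>u \<noteq> w\<close> by auto
      next
        case 3
        then show ?thesis using uw \<phi>(2) by auto
      qed
    qed
    moreover have "\<forall>u\<in>insert x W. (\<phi>(x := c)) u \<le> d" using \<phi>(1) c(1) by auto
    ultimately show ?case by blast
  qed
  from this[OF subset_refl] show ?thesis using H_subset_V by (simp add: Int_absorb2)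
qed

text \<open>The least \<open>i\<close> satisfying the upper bound works: minimality gives the lower
  one, and \<open>card_N\<close> forces \<open>i < m\<close>.\<close>

lemma level_range_exists:
  assumes "8 * t \<le> card (N v)"
  shows "\<exists>i<m. in_level_range v i"
proof -
  define i where "i = (LEAST i. card (N v) \<le> 8 * t * 2 ^ Suc i)"
  have "card (N v) \<le> 2 ^ Suc (m - 1)" using card_N m_pos by simp
  also have "\<dots> \<le> 8 * t * 2 ^ Suc (m - 1)" using m_pos t_large by simp
  finally have last: "card (N v) \<le> 8 * t * 2 ^ Suc (m - 1)" .
  then have "i \<le> m - 1" unfolding i_def by (rule Least_le)
  moreover have up: "card (N v) \<le> 8 * t * 2 ^ Suc i" unfolding i_def using last by (rule LeastI)
  moreover have "8 * t * 2 ^ i \<le> card (N v)"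
  proof (cases i)
    case 0
    then show ?thesis using assms by simp
  next
    case (Suc j)
    then have "j < i" by simp
    then have "\<not> card (N v) \<le> 8 * t * 2 ^ Suc j" unfolding i_def by (rule not_less_Least)
    then show ?thesis using Suc by simp
  qed
  ultimately show ?thesis using m_pos by (intro exI[of _ i]) (auto simp: in_level_range_def)
qed

text \<open>Conflicting vertices get distinct colours: by level or \<open>r\<close> if both are
  good, by \<open>\<phi>\<close> if neither is, by palette otherwise. So small neighbourhoods are
  rainbow. In a large one the witness from \<open>colours_exist\<close> is good and stays unique,
  since no recoloured vertex can take its colour.\<close>

lemma conflict_free_colouring:
  assumes small: "\<And>v u w. v \<in> V \<Longrightarrow> card (N v) < 8 * t \<Longrightarrow> u \<in> N v \<Longrightarrow> w \<in> N v \<Longrightarrow> u \<noteq> w \<Longrightarrow> w \<in> H u"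
    and nonempty: "\<And>v. v \<in> V \<Longrightarrow> N v \<noteq> {}"
  shows "\<exists>f :: 'a \<Rightarrow> nat. f ` V \<subseteq> {..<65 * d + 32 * m + 640 * t * m + 1} \<and>
    (\<forall>v\<in>V. \<exists>c. \<exists>!u. u \<in> N v \<and> f u = c)"
proof -
  define Q where "Q i = 16 * (2 * (d div 2 ^ i + 1) + 40 * t)" for i
  obtain lev where lev: "\<And>v i. v \<in> V \<Longrightarrow> i < m \<Longrightarrow> in_level_range v i \<Longrightarrow>
        t \<le> card {u \<in> N v. lev u = i} \<and> card {u \<in> N v. lev u = i} \<le> 32 * t"
      "\<And>v i. v \<in> V \<Longrightarrow> i < m \<Longrightarrow> card {w \<in> H v. lev w = i} \<le> 2 * (d div 2 ^ i + 1) + 8 * t"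
    using levels_exist by blast
  from colours_exist[OF lev Q_def] obtain r :: "'a \<Rightarrow> nat" where r: "\<forall>u\<in>V. r u < Q (lev u)"
    "\<forall>v\<in>V. \<forall>i<m. in_level_range v i \<longrightarrow> (\<exists>u\<in>N v. lev u = i \<and>
       (\<forall>w\<in>H u \<union> N v - {u}. lev w = i \<longrightarrow> r w \<noteq> r u))" by blast
  obtain \<phi> :: "'a \<Rightarrow> nat" where \<phi>: "\<forall>u\<in>V. \<phi> u \<le> d" "\<forall>u\<in>V. \<forall>w\<in>H u. \<phi> u \<noteq> \<phi> w"
    using proper_colouring by blast
  \<comment> \<open>Nothing bounds \<open>lev\<close> by \<open>m\<close>; vertices of higher level
    go to the palette of \<open>\<phi>\<close>, so only \<open>m\<close> level palettes are
    counted.\<close>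
  define good where "good u \<longleftrightarrow> lev u < m \<and> (\<forall>w\<in>H u. lev w = lev u \<longrightarrow> r w \<noteq> r u)" for u
  define f where "f u = (if good u then Inl (lev u, r u) else Inr (\<phi> u))" for u
  define K where "K = (SIGMA i:{..<m}. {..<Q i}) <+> {..d}"
  have fK: "f u \<in> K" if "u \<in> V" for u
    using that r(1) \<phi>(1) by (auto simp: f_def K_def good_def)
  have finK: "finite K" by (simp add: K_def)
  have "card K = (\<Sum>i<m. Q i) + (d + 1)"
    by (simp add: K_def card_Plus)
  also have "(\<Sum>i<m. Q i) = 32 * (\<Sum>i<m. d div 2 ^ i) + 32 * m + 640 * t * m"
    by (simp add: Q_def sum_distrib_left[symmetric] sum.distrib algebra_simps)
  also have "32 * (\<Sum>i<m. d div 2 ^ i) \<le> 64 * d"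
    using sum_div_power2_le[of d m] by linarith
  finally have cK: "card K \<le> 65 * d + 32 * m + 640 * t * m + 1" by simp
  obtain g where g: "bij_betw g K {0..<card K}" using ex_bij_betw_finite_nat[OF finK] by blast
  have H_distinct: "f u \<noteq> f w" if "u \<in> V" "w \<in> H u" for u w
    using that \<phi>(2) by (auto simp: f_def good_def)
  have "\<exists>u\<in>N v. \<forall>w\<in>N v - {u}. f w \<noteq> f u" if v: "v \<in> V" for v
  proof (cases "card (N v) < 8 * t")
    case True
    obtain u where u: "u \<in> N v" using nonempty[OF v] by blast
    have "f w \<noteq> f u" if "w \<in> N v - {u}" for w
      using H_distinct[of u w] small[OF v True u, of w] that u N_sub[of v] by auto
    then show ?thesis using u by blast
  next
    case False
    then obtain i where i: "i < m" "in_level_range v i" using level_range_exists[of v] by auto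
    then obtain u where u: "u \<in> N v" "lev u = i"
        "\<forall>w\<in>H u \<union> N v - {u}. lev w = i \<longrightarrow> r w \<noteq> r u"
      using r(2) v by blast
    \<comment> \<open>Irreflexivity of \<open>H\<close> ensures that \<open>- {u}\<close> in the
      property of \<open>u\<close> discards no conflict.\<close>
    have "good u" using u i H_irrefl[of u] by (auto simp: good_def)
    then have "f w \<noteq> f u" if "w \<in> N v - {u}" for w
      using u that by (auto simp: f_def)
    then show ?thesis using u(1) by blast
  qed
  then have unique: "\<exists>c. \<exists>!u. u \<in> N v \<and> (g \<circ> f) u = c" if v: "v \<in> V" for v
  proof -
    obtain u where u: "u \<in> N v" "\<forall>w\<in>N v - {u}. f w \<noteq> f u"
      using \<open>\<And>v. v \<in> V \<Longrightarrow> \<exists>u\<in>N v. \<forall>w\<in>N v - {u}. f w \<noteq> f u\<close>[OF v] by blast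
    have "w = u" if "w \<in> N v" "g (f w) = g (f u)" for w
    proof -
      have "f w \<in> K" "f u \<in> K" using that u N_sub fK by blast+
      then have "f w = f u" using that g by (meson bij_betw_def inj_onD)
      then show ?thesis using u that by auto
    qed
    then have "\<exists>!w. w \<in> N v \<and> (g \<circ> f) w = g (f u)" using u(1) by (intro ex1I[of _ u]) auto
    then show ?thesis by blast
  qed
  have "(g \<circ> f) ` V \<subseteq> {..<65 * d + 32 * m + 640 * t * m + 1}"
  proof (rule image_subsetI)
    fix u assume "u \<in> V"
    then have "g (f u) \<in> {0..<card K}" using g fK by (meson bij_betwE)
    then show "(g \<circ> f) u \<in> {..<65 * d + 32 * m + 640 * t * m + 1}" using cK by simp
  qed
  then show ?thesis using unique by blast
qed

end

section \<open>Star-free graphs\<close>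

text \<open>Otherwise \<open>k\<close> elements of \<open>I\<close> together with \<open>u\<close>
  induce the star, \<open>u\<close> being sent to the centre 0.\<close>

lemma star_free_independent_card:
  assumes G: "simple_graph V E" and free: "star_free k V E"
    and uV: "u \<in> V" and I: "I \<subseteq> open_nbhd V E u" "\<And>x y. x \<in> I \<Longrightarrow> y \<in> I \<Longrightarrow> {x, y} \<notin> E"
  shows "card I < k"
proof (rule ccontr)
  assume "\<not> card I < k"
  then obtain J where J: "J \<subseteq> I" "card J = k" "finite J"
    by (meson not_less obtain_subset_with_card_n)
  obtain h where "bij_betw h {1..card J} J" using ex_bij_betw_nat_finite_1[OF J(3)] by blast
  then obtain g where g: "bij_betw g J {1..k}" using bij_betw_inv J(2) by blast
  have loop: "{x, x} \<notin> E" for x using G by (auto simp: simple_graph_def)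
  have adj: "{x, u} \<in> E" "x \<in> V" "{u, x} \<in> E" if "x \<in> J" for x
    using that J(1) I(1) by (auto simp: open_nbhd_def insert_commute)
  have uJ: "u \<notin> J" using adj loop by blast
  define W where "W = insert u J"
  define f where "f x = (if x = u then 0 else g x)" for x
  have star: "{a, b} \<in> star_edges k \<longleftrightarrow> a = 0 \<and> b \<in> {1..k} \<or> b = 0 \<and> a \<in> {1..k}" for a b
    unfolding star_edges_def by (auto simp: doubleton_eq_iff)
  have gJ: "g x \<in> {1..k}" if "x \<in> J" for x using g that by (meson bij_betwE)
  have "bij_betw f J {1..k}"
    using g by (rule bij_betw_cong[THEN iffD1, rotated]) (use uJ in \<open>auto simp: f_def\<close>)
  then have "bij_betw f (insert u J) (insert (f u) {1..k})"
    using uJ notIn_Un_bij_betw3[of u J f "{1..k}"] by (simp add: f_def)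
  moreover have "insert (f u) {1..k} = star_verts k" by (auto simp: f_def star_verts_def)
  moreover have "{x, y} \<in> induced_edges E W \<longleftrightarrow> {f x, f y} \<in> star_edges k"
    if "x \<in> W" "y \<in> W" for x y
  proof -
    have "{x, y} \<in> induced_edges E W \<longleftrightarrow> {x, y} \<in> E" using that by (simp add: induced_edges_def)
    moreover consider "x = u" "y = u" | "x = u" "y \<in> J" | "x \<in> J" "y = u" | "x \<in> J" "y \<in> J"
      using \<open>x \<in> W\<close> \<open>y \<in> W\<close> unfolding W_def by blast
    then have "{x, y} \<in> E \<longleftrightarrow> {f x, f y} \<in> star_edges k"
    proof cases
      case 1
      then show ?thesis using loop[of u] star[of 0 0] by (simp add: f_def)
    next
      case 2
      then show ?thesis using adj gJ uJ star by (auto simp: f_def)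
    next
      case 3
      then show ?thesis using adj gJ uJ star by (auto simp: f_def)
    next
      case 4
      then have "{x, y} \<notin> E" using I(2) J(1) by blast
      moreover have "f x \<noteq> 0" "f y \<noteq> 0" using 4 gJ uJ by (force simp: f_def)+
      ultimately show ?thesis using star by simp
    qed
    ultimately show ?thesis by simp
  qed
  ultimately have "graph_isomorphic W (induced_edges E W) (star_verts k) (star_edges k)"
    unfolding graph_isomorphic_def W_def by auto
  moreover have "W \<subseteq> V" using uV adj by (auto simp: W_def)
  ultimately show False using free unfolding star_free_def by blast
qed

text \<open>A largest independent set \<open>I\<close> among these neighbours dominates them, as an
  uncovered one could be added. The strict degree bound leaves room for the vertex itself, so each
  of fewer than \<open>k\<close> closed neighbourhoods has at most \<open>s\<close>
  elements.\<close>

lemma star_free_low_degree_neighbours: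
  assumes G: "simple_graph V E" and free: "star_free k V E"
    and u: "u \<in> V"
  shows "card {x \<in> open_nbhd V E u. card (open_nbhd V E x) < s} \<le> k * s"
proof -
  define L where "L = {x \<in> open_nbhd V E u. card (open_nbhd V E x) < s}"
  define indep where "indep I \<longleftrightarrow> I \<subseteq> L \<and> (\<forall>x\<in>I. \<forall>y\<in>I. {x, y} \<notin> E)" for I
  have finV: "finite V" and loop: "{x, x} \<notin> E" for x using G by (auto simp: simple_graph_def)
  have finN: "finite (open_nbhd V E x)" for x using finV by (simp add: open_nbhd_def)
  have finL: "finite L" using finN by (simp add: L_def)
  have less: "card I < k" if "indep I" for I
    using that by (intro star_free_independent_card[OF G free u]) (auto simp: indep_def L_def)
  have "\<exists>I. indep I \<and> (\<forall>J. indep J \<longrightarrow> card J \<le> card I)"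
    using less by (intro ex_has_greatest_nat[of indep "{}" card k]) (auto simp: indep_def intro: less_imp_le)
  then obtain I where I: "indep I" "\<And>J. indep J \<Longrightarrow> card J \<le> card I" by blast
  have finI: "finite I" using I(1) finL finite_subset by (auto simp: indep_def)
  have "L \<subseteq> (\<Union>x\<in>I. insert x (open_nbhd V E x))"
  proof
    fix y assume y: "y \<in> L"
    show "y \<in> (\<Union>x\<in>I. insert x (open_nbhd V E x))"
    proof (rule ccontr)
      assume n: "y \<notin> (\<Union>x\<in>I. insert x (open_nbhd V E x))"
      have "y \<in> V" using y by (auto simp: L_def open_nbhd_def)
      then have "\<forall>x\<in>I. {y, x} \<notin> E" using n by (auto simp: open_nbhd_def)
      then have "indep (insert y I)" using I(1) y loop by (auto simp: indep_def insert_commute)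
      from I(2)[OF this] show False using n finI by (auto simp: card_insert_if split: if_splits)
    qed
  qed
  then have "card L \<le> card (\<Union>x\<in>I. insert x (open_nbhd V E x))"
    using finI finN by (intro card_mono) auto
  also have "\<dots> \<le> (\<Sum>x\<in>I. card (insert x (open_nbhd V E x)))" by (rule card_UN_le[OF finI])
  also have "\<dots> \<le> of_nat (card I) * s"
  proof (rule sum_bounded_above)
    fix x assume "x \<in> I"
    then have "card (open_nbhd V E x) < s" using I(1) by (auto simp: indep_def L_def)
    then show "card (insert x (open_nbhd V E x)) \<le> s"
      using card_insert_le_m1 finN by (simp add: card_insert_if)
  qed
  also have "\<dots> \<le> k * s" using less[OF I(1)] by simp
  finally show ?thesis unfolding L_def .
qed

section \<open>The logarithmic bound\<close>

lemma cfon_chromatic_number_le_log_squared: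
  assumes k: "k \<ge> 1" and G: "simple_graph V E" and free: "star_free k V E"
    and iso: "\<nexists>v. isolated_vertex V E v" and deg: "max_degree V E \<le> 2 ^ m" and m: "m \<ge> 1"
  shows "cfon_chromatic_number V E \<le> 824353 * k * m\<^sup>2"
proof -
  \<comment> \<open>The threshold \<open>8 * t\<close> of the locale, for the least admissible
    \<open>t = 14 * m\<close>.\<close>
  define s where "s = 8 * (14 * m)"
  define N where "N = open_nbhd V E"
  define H where "H u = {w. w \<noteq> u \<and> (\<exists>x. card (N x) < s \<and> u \<in> N x \<and> w \<in> N x)}" for u
  have finV: "finite V" using G by (simp add: simple_graph_def)
  have finN: "finite (N x)" for x using finV by (simp add: N_def open_nbhd_def)
  have sym: "u \<in> N v \<Longrightarrow> v \<in> N u" for u v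
    using G by (auto simp: N_def open_nbhd_def simple_graph_def insert_commute)
  have subV: "N v \<subseteq> V" for v by (auto simp: N_def open_nbhd_def)
  have HN: "H u \<subseteq> (\<Union>x\<in>{x \<in> N u. card (N x) < s}. N x)" for u
    using sym by (auto simp: H_def)
  have "nbhd_system V N H m (k * s * s) (14 * m)"
  proof
    show "card (N v) \<le> 2 ^ m" for v
    proof (cases "v \<in> V")
      case True
      then have "card (N v) \<le> max_degree V E"
        unfolding max_degree_def N_def using finV by (intro Max_ge) auto
      then show ?thesis using deg by linarith
    next
      \<comment> \<open>The locale speaks about the whole type; outside \<open>V\<close>
        neighbourhoods are empty by symmetry.\<close>
      case False
      then have "N v = {}" using sym subV by blast
      then show ?thesis by simp
    qed
    show "H u \<subseteq> (\<Union>w\<in>N u. N w)" for u using HN by blast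
    show "card (H u) \<le> k * s * s" for u
    proof -
      let ?L = "{x \<in> N u. card (N x) < s}"
      have fL: "finite ?L" using finN by simp
      have "card (H u) \<le> card (\<Union>x\<in>?L. N x)" using HN finN by (intro card_mono) auto
      also have "\<dots> \<le> (\<Sum>x\<in>?L. card (N x))" by (rule card_UN_le[OF fL])
      also have "\<dots> \<le> of_nat (card ?L) * s" by (intro sum_bounded_above) auto
      also have "\<dots> \<le> k * s * s"
      proof (cases "u \<in> V")
        case True
        then show ?thesis
          using star_free_low_degree_neighbours[OF G free True, of s] by (simp add: N_def)
      next
        case False
        then have "N u = {}" using sym subV by blast
        then show ?thesis by simp
      qed
      finally show ?thesis .
    qed
  qed (use finV subV sym m in \<open>auto simp: H_def\<close>)
  then interpret nbhd_system V N H m "k * s * s" "14 * m" .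
  have "\<exists>f :: 'a \<Rightarrow> nat. f ` V \<subseteq> {..<65 * (k * s * s) + 32 * m + 640 * (14 * m) * m + 1} \<and>
    (\<forall>v\<in>V. \<exists>c. \<exists>!u. u \<in> N v \<and> f u = c)"
  proof (rule conflict_free_colouring)
    show "N v \<noteq> {}" if "v \<in> V" for v using iso that by (auto simp: isolated_vertex_def N_def)
  qed (auto simp: H_def s_def)
  then have "cfon_chromatic_number V E \<le> 65 * (k * s * s) + 32 * m + 640 * (14 * m) * m + 1"
    unfolding cfon_chromatic_number_def cfon_coloring_def N_def by (rule Least_le)
  \<comment> \<open>Here \<open>815360 = 65 * 112\<^sup>2\<close> because
    \<open>s = 112 * m\<close>. The lower-order terms are absorbed next, giving 824353 in
    total.\<close>
  also have "\<dots> = 815360 * (k * m\<^sup>2) + 32 * m + 8960 * m\<^sup>2 + 1"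
    by (simp add: s_def power2_eq_square)
  also have "\<dots> \<le> 815360 * (k * m\<^sup>2) + 32 * (k * m\<^sup>2) + 8960 * (k * m\<^sup>2) + k * m\<^sup>2"
  proof -
    have "m \<le> m\<^sup>2" using m by (simp add: power2_eq_square)
    moreover have "m\<^sup>2 \<le> k * m\<^sup>2" using k by simp
    ultimately show ?thesis using m by linarith
  qed
  also have "\<dots> = 824353 * k * m\<^sup>2" by simp
  finally show ?thesis .
qed

text \<open>At maximum degree 1 the logarithm vanishes although a colour is needed; hence the
  restriction to degree at least 2.\<close>

theorem theorem1:
  fixes \<epsilon> :: real
  assumes "\<epsilon> > 0"
  shows "\<exists>c::real. c > 0 \<and>
    (\<forall>(k::nat) (V :: 'a set) E.
       k \<ge> 1 \<longrightarrow> simple_graph V E \<longrightarrow> star_free k V E \<longrightarrow>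
       (\<nexists>v. isolated_vertex V E v) \<longrightarrow> max_degree V E \<ge> 2 \<longrightarrow>
       real (cfon_chromatic_number V E)
         \<le> c * real k * ln (real (max_degree V E)) powr (2 + \<epsilon>))"
proof (intro exI[of _ "824353 * 16 / ln 2 powr \<epsilon>"] conjI allI impI)
  show "0 < 824353 * 16 / ln (2::real) powr \<epsilon>" by simp
  fix k :: nat and V :: "'a set" and E
  assume k: "k \<ge> 1" and G: "simple_graph V E" and free: "star_free k V E"
    and iso: "\<nexists>v. isolated_vertex V E v" and deg: "max_degree V E \<ge> 2"
  define \<Delta> where "\<Delta> = max_degree V E"
  define l where "l = ln (real \<Delta>)"
  \<comment> \<open>The binary logarithm rounded up. Minimality gives
    \<open>m * ln 2 \<le> l + ln 2 \<le> 2 * l\<close>, and \<open>ln 2 \<ge> 1 / 2\<close> then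
    yields \<open>m \<le> 4 * l\<close>, the source of the factor 16.\<close>
  define m where "m = (LEAST m. \<Delta> \<le> 2 ^ m)"
  have \<Delta>: "\<Delta> \<ge> 2" using deg by (simp add: \<Delta>_def)
  have m: "\<Delta> \<le> 2 ^ m" unfolding m_def by (rule LeastI[of _ \<Delta>]) (simp add: less_imp_le)
  have m1: "m \<ge> 1" using m \<Delta> by (cases m) auto
  have "\<not> \<Delta> \<le> 2 ^ (m - 1)"
    using not_less_Least[of "m - 1" "\<lambda>m. \<Delta> \<le> 2 ^ m"] m1 by (simp add: m_def[symmetric])
  then have "real (2 ^ (m - 1)) \<le> real \<Delta>" by linarith
  then have "ln (real (2 ^ (m - 1))) \<le> l" unfolding l_def using \<Delta> by (intro ln_mono) auto
  then have "real (m - 1) * ln 2 \<le> l" by (simp add: ln_realpow)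
  then have "real m * ln 2 - ln 2 \<le> l" using m1 by (simp add: of_nat_diff algebra_simps)
  moreover have l2: "ln 2 \<le> l" unfolding l_def using \<Delta> by (intro ln_mono) auto
  ultimately have "real m * ln 2 \<le> 2 * l" by linarith
  moreover have "1 / 2 \<le> ln (2::real)" using ln_le_minus_one[of "1 / 2"] by (simp add: ln_div)
  then have "real m * (1 / 2) \<le> real m * ln 2" by (intro mult_left_mono) auto
  ultimately have ml: "real m \<le> 4 * l" by linarith
  have lpos: "l > 0" using l2 ln_gt_zero[of "2::real"] by linarith
  have "real (cfon_chromatic_number V E) \<le> real (824353 * k * m\<^sup>2)"
    using cfon_chromatic_number_le_log_squared[OF k G free iso _ m1] m by (intro of_nat_mono) (simp add: \<Delta>_def)
  also have "\<dots> = 824353 * real k * (real m)\<^sup>2" by simp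
  also have "\<dots> \<le> 824353 * real k * (4 * l)\<^sup>2"
    using ml by (intro mult_left_mono power_mono) auto
  also have "\<dots> = 824353 * 16 * real k * (l\<^sup>2 * 1)" by (simp add: power2_eq_square)
  \<comment> \<open>Since \<open>l \<ge> ln 2\<close>, the inserted quotient is at least 1; its
    denominator is the one in the constant.\<close>
  also have "\<dots> \<le> 824353 * 16 * real k * (l\<^sup>2 * (l powr \<epsilon> / ln 2 powr \<epsilon>))"
    using powr_mono2[of \<epsilon> "ln 2" l] assms l2 by (intro mult_left_mono) auto
  also have "\<dots> = 824353 * 16 / ln 2 powr \<epsilon> * real k * l powr (2 + \<epsilon>)"
    using lpos by (simp add: powr_add powr_realpow)
  finally show "real (cfon_chromatic_number V E)
      \<le> 824353 * 16 / ln 2 powr \<epsilon> * real k * ln (real (max_degree V E)) powr (2 + \<epsilon>)"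
    by (simp add: l_def \<Delta>_def)
qed

end
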